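(* The category $\mathsf{P}_{\mathbb{Z}}$ of rational polyhedra and $\mathbb{Z}$-maps has finite co-products (including the empty one), and has pushouts of strict $\mathbb{Z}$-maps: for all rational polyhedra $P,Q,R$ and all strict $\mathbb{Z}$-maps $\eta\colon P\to Q$ and $\mu\colon P\to R$, the pushout of $\eta$ and $\mu$ exists in $\mathsf{P}_{\mathbb{Z}}$.
   Context: A rational simplex in $\mathbb{R}^n$ is the convex hull of finitely many affinely independent points with rational coordinates. A rational polyhedron in $\mathbb{R}^n$ is a finite union of (closed) rational simplexes in $\mathbb{R}^n$ (the empty set is allowed). A triangulation of a rational polyhedron $P$ is a (finite) simplicial complex $\Delta$ consisting of rational simplexes whose union is $P$. For a rational polyhedron $P\subseteq\mathbb{R}^n$, a map $\eta\colon P\to\mathbb{R}^m$ is a $\mathbb{Z}$-map if there is a triangulation $\Delta$ of $P$ such that over every simplex $T\in\Delta$, $\eta$ coincides with an affine linear map $x\mapsto M_Tx+b_T$ with integer coefficients (integer matrix $M_T$, integer vector $b_T$). A $\mathbb{Z}$-map $\eta\colon P\to Q$ into a rational polyhedron $Q\subseteq\mathbb{R}^m$ is a $\mathbb{Z}$-map $P\to\mathbb{R}^m$ with $\eta(P)\subseteq Q$. The image of a rational polyhedron under a $\mathbb{Z}$-map is again a rational polyhedron. $\mathsf{P}_{\mathbb{Z}}$ is the category whose objects are rational polyhedra in $\mathbb{R}^n$ for $n=1,2,\ldots$, and whose arrows are $\mathbb{Z}$-maps. A $\mathbb{Z}$-homeomorphism is a one-one $\mathbb{Z}$-map of $P$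 onto $Q$ whose inverse is also a $\mathbb{Z}$-map. A $\mathbb{Z}$-map $\eta\colon P\to Q$ is strict if it is a $\mathbb{Z}$-homeomorphism of $P$ onto its range $\eta(P)$. *)

theory Defs
  imports "HOL-Analysis.Analysis" "HOL-Analysis.Finite_Function_Topology" "HOL-Library.FuncSet"
begin

text \<open>
  Objects of the category live in all dimensions at once, so the dimension cannot be a type.
  The space \<open>\<real>\<^sup>n\<close> is the subspace of the real vector space \<open>nat \<Rightarrow>\<^sub>0 real\<close> consisting of the
  vectors supported on the coordinates \<open>0, \<dots>, n - 1\<close>; this makes the library's
  \<^const>\<open>convex\<close>, \<^const>\<open>hull\<close>, \<^const>\<open>affine_dependent\<close> and \<^const>\<open>face_of\<close> available.
\<close>

type_synonym point = "nat \<Rightarrow>\<^sub>0 real"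

definition Rspace :: "nat \<Rightarrow> point set" where
  "Rspace n = {x. Poly_Mapping.keys x \<subseteq> {..<n}}"

definition rational_simplex :: "nat \<Rightarrow> point set \<Rightarrow> bool" where
  "rational_simplex n T \<longleftrightarrow>
     (\<exists>V. finite V \<and> V \<subseteq> Rspace n \<and> (\<forall>v\<in>V. \<forall>i<n. Poly_Mapping.lookup v i \<in> \<rat>) \<and>
          \<not> affine_dependent V \<and> T = convex hull V)"

definition rational_polyhedron :: "nat \<Rightarrow> point set \<Rightarrow> bool" where
  "rational_polyhedron n P \<longleftrightarrow>
     (\<exists>\<F>. finite \<F> \<and> (\<forall>T\<in>\<F>. rational_simplex n T) \<and> P = \<Union>\<F>)"

text \<open>
  The simplicial complex conditions are those of \<^const>\<open>simplicial_complex\<close>, which is only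
  available for types of class \<^class>\<open>euclidean_space\<close>. As there, the empty set counts as a
  simplex and as a face of every simplex.
\<close>

definition rational_triangulation :: "nat \<Rightarrow> point set \<Rightarrow> point set set \<Rightarrow> bool" where
  "rational_triangulation n P \<Delta> \<longleftrightarrow>
     finite \<Delta> \<and>
     (\<forall>T\<in>\<Delta>. rational_simplex n T) \<and>
     (\<forall>F T. T \<in> \<Delta> \<and> F face_of T \<longrightarrow> F \<in> \<Delta>) \<and>
     (\<forall>T T'. T \<in> \<Delta> \<and> T' \<in> \<Delta> \<longrightarrow> (T \<inter> T') face_of T) \<and>
     \<Union>\<Delta> = P"

definition integer_affine_on :: "nat \<Rightarrow> nat \<Rightarrow> point set \<Rightarrow> (point \<Rightarrow> point) \<Rightarrow> bool" where
  "integer_affine_on n m T \<eta> \<longleftrightarrow>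
     (\<exists>(M :: nat \<Rightarrow> nat \<Rightarrow> int) (b :: nat \<Rightarrow> int). \<forall>x\<in>T.
        \<eta> x \<in> Rspace m \<and>
        (\<forall>i<m. Poly_Mapping.lookup (\<eta> x) i =
                (\<Sum>j<n. of_int (M i j) * Poly_Mapping.lookup x j) + of_int (b i)))"

definition Zmap :: "nat \<Rightarrow> point set \<Rightarrow> nat \<Rightarrow> (point \<Rightarrow> point) \<Rightarrow> bool" where
  "Zmap n P m \<eta> \<longleftrightarrow>
     rational_polyhedron n P \<and>
     (\<exists>\<Delta>. rational_triangulation n P \<Delta> \<and> (\<forall>T\<in>\<Delta>. integer_affine_on n m T \<eta>))"

text \<open>
  An object is a rational polyhedron together with the dimension of its ambient space.
  Arrows are made extensional (undefined outside the polyhedron), so that equality of arrows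
  between two given objects is equality of functions on the domain. Composition is
  \<^const>\<open>compose\<close> and takes the domain as its first argument.
\<close>

type_synonym polyhedron_obj = "nat \<times> point set"

definition PZ_obj :: "polyhedron_obj set" where
  "PZ_obj = {(n, P). 1 \<le> n \<and> rational_polyhedron n P}"

definition PZ_hom :: "polyhedron_obj \<Rightarrow> polyhedron_obj \<Rightarrow> (point \<Rightarrow> point) set" where
  "PZ_hom A B =
     {\<eta> \<in> extensional (snd A). Zmap (fst A) (snd A) (fst B) \<eta> \<and> \<eta> ` snd A \<subseteq> snd B}"

definition Z_homeomorphism :: "polyhedron_obj \<Rightarrow> polyhedron_obj \<Rightarrow> (point \<Rightarrow> point) \<Rightarrow> bool" where
  "Z_homeomorphism A B \<eta> \<longleftrightarrow>
     \<eta> \<in> PZ_hom A B \<and> inj_on \<eta> (snd A) \<and> \<eta> ` snd A = snd B \<and>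
     restrict (inv_into (snd A) \<eta>) (snd B) \<in> PZ_hom B A"

definition strict_Zmap :: "polyhedron_obj \<Rightarrow> polyhedron_obj \<Rightarrow> (point \<Rightarrow> point) \<Rightarrow> bool" where
  "strict_Zmap A B \<eta> \<longleftrightarrow>
     \<eta> \<in> PZ_hom A B \<and> Z_homeomorphism A (fst B, \<eta> ` snd A) \<eta>"

definition PZ_coproduct ::
  "'i set \<Rightarrow> ('i \<Rightarrow> polyhedron_obj) \<Rightarrow> polyhedron_obj \<Rightarrow> ('i \<Rightarrow> point \<Rightarrow> point) \<Rightarrow> bool" where
  "PZ_coproduct I A C \<iota> \<longleftrightarrow>
     C \<in> PZ_obj \<and> (\<forall>i\<in>I. \<iota> i \<in> PZ_hom (A i) C) \<and>
     (\<forall>D\<in>PZ_obj. \<forall>f. (\<forall>i\<in>I. f i \<in> PZ_hom (A i) D) \<longrightarrow>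
        (\<exists>!h. h \<in> PZ_hom C D \<and> (\<forall>i\<in>I. compose (snd (A i)) h (\<iota> i) = f i)))"

definition PZ_pushout ::
  "polyhedron_obj \<Rightarrow> polyhedron_obj \<Rightarrow> polyhedron_obj \<Rightarrow> (point \<Rightarrow> point) \<Rightarrow> (point \<Rightarrow> point) \<Rightarrow>
   polyhedron_obj \<Rightarrow> (point \<Rightarrow> point) \<Rightarrow> (point \<Rightarrow> point) \<Rightarrow> bool" where
  "PZ_pushout P Q R \<eta> \<mu> S \<sigma> \<tau> \<longleftrightarrow>
     S \<in> PZ_obj \<and> \<sigma> \<in> PZ_hom Q S \<and> \<tau> \<in> PZ_hom R S \<and>
     compose (snd P) \<sigma> \<eta> = compose (snd P) \<tau> \<mu> \<and>
     (\<forall>D\<in>PZ_obj. \<forall>f\<in>PZ_hom Q D. \<forall>g\<in>PZ_hom R D.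
        compose (snd P) f \<eta> = compose (snd P) g \<mu> \<longrightarrow>
        (\<exists>!h. h \<in> PZ_hom S D \<and> compose (snd Q) h \<sigma> = f \<and> compose (snd R) h \<tau> = g))"

end

theory Submission
  imports Defs
begin

text \<open>
  Both constructions glue finitely many polyhedra \<open>P\<^sub>i\<close> inside one ambient space. Suppose that each
  \<open>P\<^sub>i\<close> is mapped to \<open>\<real>\<^sup>m\<close> by a Z-map \<open>\<iota>\<^sub>i\<close> which has an integer affine left inverse defined on all of
  \<open>\<real>\<^sup>m\<close>, and let \<open>C\<close> be the union of the images. Then Z-maps \<open>C \<rightarrow> D\<close> are the same as families of
  Z-maps \<open>P\<^sub>i \<rightarrow> D\<close> that agree wherever two points have the same image (\<open>glue_universal\<close>). For the
  coproduct, \<open>\<iota>\<^sub>i x = (x, i)\<close> in a space of sufficiently large dimension makes the images disjoint.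

  For the pushout of \<open>\<eta> : P \<rightarrow> Q\<close> and \<open>\<mu> : P \<rightarrow> R\<close>, strictness makes \<open>\<mu> \<circ> \<eta>\<^sup>-\<^sup>1\<close> a Z-map on \<open>\<eta>(P)\<close> and
  \<open>\<eta> \<circ> \<mu>\<^sup>-\<^sup>1\<close> a Z-map on \<open>\<mu>(P)\<close>. Both extend to piecewise integer affine maps \<open>\<Theta>\<close> and \<open>\<Theta>'\<close> on the whole
  ambient spaces (\<open>Zmap_extension\<close>), and there is a piecewise integer affine function \<open>\<delta>\<close> whose zero
  set is \<open>\<eta>(P)\<close> (\<open>polyhedron_zero_form\<close>). Put \<open>\<sigma> x = (x, \<Theta> x, \<delta> x)\<close> on \<open>Q\<close> and
  \<open>\<tau> y = (\<Theta>' y, y, 0)\<close> on \<open>R\<close>. Coordinate projections are left inverses, \<open>\<sigma> (\<eta> p) = \<tau> (\<mu> p)\<close> for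
  \<open>p \<in> P\<close>, and \<open>\<sigma> x = \<tau> y\<close> forces \<open>\<delta> x = 0\<close>, so that \<open>x\<close> and \<open>y\<close> come from a common point of \<open>P\<close>.
  Hence the union of \<open>\<sigma>(Q)\<close> and \<open>\<tau>(R)\<close> is the pushout.

  The extension is the classical max-min construction. If the Z-map is given by the integer form
  \<open>l\<^sub>T\<close> on the polytope \<open>T\<close>, and \<open>d\<^sub>T \<ge> 0\<close> is piecewise integer affine with zero set \<open>T\<close>, then for
  large \<open>N\<close> the function \<open>max\<^sub>T (l\<^sub>T - N d\<^sub>T)\<close> is an extension, because \<open>l\<^sub>T - l\<^sub>T' \<le> N d\<^sub>T\<close> on every
  piece \<open>T'\<close> (\<open>domination_on_polytope\<close>).

  The definition of a Z-map asks for a triangulation, which is inconvenient for composing, gluing and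
  refining. The technical core is that any finite cover by rational polytopes, given by linear
  inequalities, is refined by a rational triangulation (\<open>triangulation_refining\<close>), so that a map is
  a Z-map as soon as it is integer affine on each member of such a cover (\<open>ZmapI\<close>). The triangulation
  is a barycentric subdivision of the cell complex cut out by the hyperplanes of all the
  inequalities: each cell is the set of points with a prescribed vector of signs, it contains a
  rational point, and the simplexes are spanned by the chosen points of chains of cells.
\<close>

section \<open>Points of the ambient spaces\<close>

lemma lookup_scaleR [simp]: "Poly_Mapping.lookup (c *\<^sub>R x) i = c * Poly_Mapping.lookup (x::point) i"
proof -
  have "finite {i. c * Poly_Mapping.lookup x i \<noteq> 0}"
    by (rule finite_subset[OF _ finite_keys[of x]]) (auto simp: in_keys_iff)
  then show ?thesis by (simp add: scaleR_poly_mapping_def Abs_poly_mapping_inverse)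
qed

lemma lookup_linear_sum:
  "Poly_Mapping.lookup (\<Sum>v\<in>V. u v *\<^sub>R (v::point)) i = (\<Sum>v\<in>V. u v * Poly_Mapping.lookup v i)"
  by (induction V rule: infinite_finite_induct) (auto simp: lookup_add)

definition point_of :: "nat \<Rightarrow> (nat \<Rightarrow> real) \<Rightarrow> point" where
  "point_of n f = Abs_poly_mapping (\<lambda>i. if i < n then f i else 0)"

lemma lookup_point_of [simp]: "Poly_Mapping.lookup (point_of n f) i = (if i < n then f i else 0)"
proof -
  have "finite {i. (if i < n then f i else 0) \<noteq> 0}"
    by (rule finite_subset[of _ "{..<n}"]) auto
  then show ?thesis by (simp add: point_of_def Abs_poly_mapping_inverse)
qed

lemma Rspace_iff: "x \<in> Rspace n \<longleftrightarrow> (\<forall>i\<ge>n. Poly_Mapping.lookup x i = 0)"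
  unfolding Rspace_def by (auto simp: subset_iff in_keys_iff) (meson not_le)

lemma point_of_in_Rspace [simp]: "point_of n f \<in> Rspace n"
  by (simp add: Rspace_iff)

lemma Rspace_eqI:
  assumes "x \<in> Rspace n" "y \<in> Rspace n"
    and "\<And>i. i < n \<Longrightarrow> Poly_Mapping.lookup x i = Poly_Mapping.lookup y i"
  shows "x = y"
  using assms by (intro poly_mapping_eqI) (metis Rspace_iff not_le)

lemma convex_Rspace: "convex (Rspace n)"
  unfolding convex_def by (auto simp: Rspace_iff lookup_add)

section \<open>Affine forms with rational or integer coefficients\<close>

definition affine_form :: "real set \<Rightarrow> nat \<Rightarrow> (point \<Rightarrow> real) \<Rightarrow> bool" where
  "affine_form K n h \<longleftrightarrow>
     (\<exists>a b. (\<forall>i<n. a i \<in> K) \<and> b \<in> K \<and> h = (\<lambda>x. (\<Sum>i<n. a i * Poly_Mapping.lookup x i) + b))"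

abbreviation rational_form :: "nat \<Rightarrow> (point \<Rightarrow> real) \<Rightarrow> bool" where
  "rational_form \<equiv> affine_form \<rat>"

abbreviation integer_form :: "nat \<Rightarrow> (point \<Rightarrow> real) \<Rightarrow> bool" where
  "integer_form \<equiv> affine_form \<int>"

lemma integer_form_imp_rational_form: "integer_form n h \<Longrightarrow> rational_form n h"
  unfolding affine_form_def using Ints_subset_Rats by blast

lemma affine_form_const: "c \<in> K \<Longrightarrow> 0 \<in> K \<Longrightarrow> affine_form K n (\<lambda>x. c)"
  unfolding affine_form_def by (rule exI[of _ "\<lambda>_. 0"]) auto

lemma affine_form_coord:
  assumes "i < n" "0 \<in> K" "1 \<in> K"
  shows "affine_form K n (\<lambda>x. Poly_Mapping.lookup x i)"
proof -
  have "(\<Sum>j<n. (if j = i then 1 else 0) * Poly_Mapping.lookup x j) = Poly_Mapping.lookup x i" for x :: point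
    using assms(1) by (simp add: if_distrib[of "\<lambda>c. c * _"] cong: if_cong)
  then show ?thesis
    unfolding affine_form_def using assms
    by (intro exI[of _ "\<lambda>j. if j = i then 1 else 0"] exI[of _ 0]) auto
qed

lemma affine_form_add:
  assumes "\<And>x y. x \<in> K \<Longrightarrow> y \<in> K \<Longrightarrow> x + y \<in> K" "affine_form K n g" "affine_form K n h"
  shows "affine_form K n (\<lambda>x. g x + h x)"
proof -
  obtain a b a' b' where "\<forall>i<n. a i \<in> K" "b \<in> K" "\<forall>i<n. a' i \<in> K" "b' \<in> K"
    and "g = (\<lambda>x. (\<Sum>i<n. a i * Poly_Mapping.lookup x i) + b)" "h = (\<lambda>x. (\<Sum>i<n. a' i * Poly_Mapping.lookup x i) + b')"
    using assms(2,3) unfolding affine_form_def by blast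
  then show ?thesis
    unfolding affine_form_def using assms(1)
    by (intro exI[of _ "\<lambda>i. a i + a' i"] exI[of _ "b + b'"]) (auto simp: sum.distrib algebra_simps)
qed

lemma affine_form_scale:
  assumes "\<And>x y. x \<in> K \<Longrightarrow> y \<in> K \<Longrightarrow> x * y \<in> K" "c \<in> K" "affine_form K n g"
  shows "affine_form K n (\<lambda>x. c * g x)"
proof -
  obtain a b where "\<forall>i<n. a i \<in> K" "b \<in> K"
    and "g = (\<lambda>x. (\<Sum>i<n. a i * Poly_Mapping.lookup x i) + b)"
    using assms(3) unfolding affine_form_def by blast
  then show ?thesis
    unfolding affine_form_def using assms(1,2)
    by (intro exI[of _ "\<lambda>i. c * a i"] exI[of _ "c * b"]) (auto simp: sum_distrib_left algebra_simps)
qed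

lemmas rational_form_const = affine_form_const[of _ \<rat>, OF _ Rats_0]
lemmas integer_form_const = affine_form_const[of _ \<int>, OF _ Ints_0]
lemmas rational_form_coord = affine_form_coord[of _ _ \<rat>, OF _ Rats_0 Rats_1]
lemmas integer_form_coord = affine_form_coord[of _ _ \<int>, OF _ Ints_0 Ints_1]

lemma rational_form_add: "rational_form n g \<Longrightarrow> rational_form n h \<Longrightarrow> rational_form n (\<lambda>x. g x + h x)"
  by (rule affine_form_add) auto

lemma rational_form_scale: "c \<in> \<rat> \<Longrightarrow> rational_form n g \<Longrightarrow> rational_form n (\<lambda>x. c * g x)"
  by (rule affine_form_scale) auto

lemma rational_form_uminus: "rational_form n g \<Longrightarrow> rational_form n (\<lambda>x. - g x)"
  using rational_form_scale[of "-1" n g] by simp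

lemma integer_form_add: "integer_form n g \<Longrightarrow> integer_form n h \<Longrightarrow> integer_form n (\<lambda>x. g x + h x)"
  by (rule affine_form_add) auto

lemma integer_form_scale: "c \<in> \<int> \<Longrightarrow> integer_form n g \<Longrightarrow> integer_form n (\<lambda>x. c * g x)"
  by (rule affine_form_scale) auto

lemma integer_form_uminus: "integer_form n g \<Longrightarrow> integer_form n (\<lambda>x. - g x)"
  using integer_form_scale[of "-1" n g] by simp

lemma rational_form_diff: "rational_form n g \<Longrightarrow> rational_form n h \<Longrightarrow> rational_form n (\<lambda>x. g x - h x)"
  using rational_form_add[of n g "\<lambda>x. (-1) * h x"] rational_form_scale[of "-1" n h] by simp

lemma integer_form_diff: "integer_form n g \<Longrightarrow> integer_form n h \<Longrightarrow> integer_form n (\<lambda>x. g x - h x)"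
  using integer_form_add[of n g "\<lambda>x. (-1) * h x"] integer_form_scale[of "-1" n h] by simp

lemma rational_form_sum:
  "(\<And>j. j \<in> J \<Longrightarrow> rational_form n (g j)) \<Longrightarrow> rational_form n (\<lambda>x. \<Sum>j\<in>J. g j x)"
  by (induction J rule: infinite_finite_induct) (simp_all add: rational_form_const rational_form_add)

lemma rational_form_compose:
  assumes "rational_form m h" "\<And>i. i < m \<Longrightarrow> rational_form n (g i)"
  shows "rational_form n (\<lambda>x. h (point_of m (\<lambda>i. g i x)))"
proof -
  obtain a b where ab: "\<forall>i<m. a i \<in> \<rat>" "b \<in> \<rat>"
    and h: "h = (\<lambda>x. (\<Sum>i<m. a i * Poly_Mapping.lookup x i) + b)"
    using assms(1) unfolding affine_form_def by blast
  have "rational_form n (\<lambda>x. (\<Sum>i\<in>{..<m}. a i * g i x) + b)"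
    using ab assms(2)
    by (intro rational_form_add rational_form_sum rational_form_scale rational_form_const) auto
  then show ?thesis by (simp add: h)
qed

lemma integer_form_sum:
  "(\<And>j. j \<in> J \<Longrightarrow> integer_form n (g j)) \<Longrightarrow> integer_form n (\<lambda>x. \<Sum>j\<in>J. g j x)"
  by (induction J rule: infinite_finite_induct) (simp_all add: integer_form_const integer_form_add)

lemma integer_form_compose:
  assumes "integer_form m h" "\<And>i. i < m \<Longrightarrow> integer_form n (g i)"
  shows "integer_form n (\<lambda>x. h (point_of m (\<lambda>i. g i x)))"
proof -
  obtain a b where ab: "\<forall>i<m. a i \<in> \<int>" "b \<in> \<int>"
    and h: "h = (\<lambda>x. (\<Sum>i<m. a i * Poly_Mapping.lookup x i) + b)"
    using assms(1) unfolding affine_form_def by blast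
  have "integer_form n (\<lambda>x. (\<Sum>i\<in>{..<m}. a i * g i x) + b)"
    using ab assms(2)
    by (intro integer_form_add integer_form_sum integer_form_scale integer_form_const) auto
  then show ?thesis by (simp add: h)
qed

lemma affine_form_segment:
  assumes "affine_form K n h" "s + t = 1"
  shows "h (s *\<^sub>R x + t *\<^sub>R y) = s * h x + t * h y"
proof -
  obtain a b where h: "h = (\<lambda>x. (\<Sum>i<n. a i * Poly_Mapping.lookup x i) + b)"
    using assms(1) unfolding affine_form_def by blast
  have "b = s * b + t * b" using assms(2) by (simp flip: distrib_right)
  then show ?thesis
    by (simp add: h lookup_add sum.distrib sum_distrib_left algebra_simps)
qed

text \<open>
  Clearing denominators: half-spaces bounded by rational hyperplanes can be described by integer forms,
  as needed for functions that are assembled from integer forms only.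
\<close>

lemma rational_form_integer_multiple:
  assumes "rational_form n h"
  obtains d :: int where "d > 0" "integer_form n (\<lambda>x. of_int d * h x)"
proof -
  obtain a b where ab: "\<forall>i<n. a i \<in> \<rat>" "b \<in> \<rat>"
    and h: "h = (\<lambda>x. (\<Sum>i<n. a i * Poly_Mapping.lookup x i) + b)"
    using assms(1) unfolding affine_form_def by blast
  have den: "\<exists>d::int. d > 0 \<and> (\<forall>q\<in>S. of_int d * q \<in> \<int>)" if "finite S" "S \<subseteq> \<rat>" for S :: "real set"
    using that
  proof (induction S rule: finite_induct)
    case empty show ?case by (rule exI[of _ 1]) simp
  next
    case (insert q S)
    obtain d where d: "d > 0" "\<forall>q\<in>S. of_int d * q \<in> \<int>" using insert by auto
    obtain e f where ef: "f > 0" "q = of_int e / of_int f" 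
      using insert.prems by (metis Rats_cases' insert_subset)
    have "of_int (d * f) * q = of_int (d * e)" using ef by simp
    moreover have "of_int (d * f) * p = of_int f * (of_int d * p)" for p :: real by simp
    ultimately have "\<forall>p\<in>insert q S. of_int (d * f) * p \<in> \<int>"
      using d by (metis Ints_mult Ints_of_int insert_iff)
    then show ?case using d(1) ef(1) by (intro exI[of _ "d * f"]) simp
  qed
  obtain d where d: "d > 0" "\<forall>q\<in>insert b (a ` {..<n}). of_int d * q \<in> \<int>"
    using den[of "insert b (a ` {..<n})"] ab by auto
  have "integer_form n (\<lambda>x. of_int d * h x)"
    unfolding affine_form_def using d(2)
    by (intro exI[of _ "\<lambda>i. of_int d * a i"] exI[of _ "of_int d * b"])
       (auto simp: h sum_distrib_left algebra_simps)
  then show ?thesis using d(1) that by blast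
qed

section \<open>Rational points with prescribed signs\<close>

lemma rational_between_finite_sets:
  fixes A B :: "real set"
  assumes "finite A" "finite B" "\<And>a b. a \<in> A \<Longrightarrow> b \<in> B \<Longrightarrow> a < b"
  shows "\<exists>t\<in>\<rat>. (\<forall>a\<in>A. a < t) \<and> (\<forall>b\<in>B. t < b)"
proof -
  have "\<exists>l u. l < u \<and> (\<forall>a\<in>A. a \<le> l) \<and> (\<forall>b\<in>B. u \<le> b)"
  proof (cases "A = {} \<or> B = {}")
    case True
    then show ?thesis
    proof
      assume "A = {}"
      moreover have "\<forall>b\<in>B. Min (insert 0 B) \<le> b" using assms(2) by (intro ballI Min_le) auto
      moreover have "Min (insert 0 B) - 1 < Min (insert 0 B)" by (rule diff_less_eq[THEN iffD2]) simp
      ultimately show ?thesis using \<open>A = {}\<close> by (metis empty_iff)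
    next
      assume "B = {}"
      then show ?thesis using assms(1) 
        by (intro exI[of _ "Max (insert 0 A)"] exI[of _ "Max (insert 0 A) + 1"]) auto
    qed
  next
    case False
    then show ?thesis using assms
      by (intro exI[of _ "Max A"] exI[of _ "Min B"]) auto
  qed
  then obtain l u where lu: "l < u" "\<forall>a\<in>A. a \<le> l" "\<forall>b\<in>B. u \<le> b" by blast
  then obtain t where "t \<in> \<rat>" "l < t" "t < u" using Rats_dense_in_real by blast
  then show ?thesis using lu by force
qed

text \<open>
  Fourier-Motzkin elimination, for sign patterns instead of solvability. A form in which the last
  variable occurs is a nonzero multiple of the difference between that variable and a form \<open>r\<close> in the
  others, so its sign is decided by how the last variable compares with \<open>r\<close>. Imposing the signs of all differences
  \<open>r - r'\<close> on the remaining variables keeps the values of these \<open>r\<close> in the same order, and a rational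
  value for the last variable can be inserted at the same place of that order.
\<close>

lemma rational_coordinates_same_signs:
  fixes x :: "nat \<Rightarrow> real" and K :: "((nat \<Rightarrow> real) \<times> real) set"
  assumes "finite K" "\<And>a b. (a, b) \<in> K \<Longrightarrow> (\<forall>i<n. a i \<in> \<rat>) \<and> b \<in> \<rat>"
  shows "\<exists>q. (\<forall>i<n. q i \<in> \<rat>) \<and>
    (\<forall>(a, b)\<in>K. sgn ((\<Sum>i<n. a i * q i) + b) = sgn ((\<Sum>i<n. a i * x i) + b))"
  using assms
proof (induction n arbitrary: K)
  case 0
  then show ?case by auto
next
  case (Suc n)
  \<comment> \<open>the form in the first n variables that gives the zero of \<open>(a, b)\<close> in the last one\<close>
  define root where "root = (\<lambda>(a, b). (\<lambda>i. - a i / a n, - b / a n :: real))"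
  define K1 where "K1 = root ` {(a, b) \<in> K. a n \<noteq> 0}"
  define D where "D = (\<lambda>((a, b), (a', b')). (\<lambda>i. a i - a' i, b - b' :: real)) ` (K1 \<times> K1)"
  define val where "val = (\<lambda>(a, b) q. (\<Sum>i<n. a i * q i) + b :: real)"
  have finK1: "finite K1" using Suc.prems(1) unfolding K1_def by (auto intro: rev_finite_subset)
  have ratK1: "(\<forall>i<n. a i \<in> \<rat>) \<and> b \<in> \<rat>" if "(a, b) \<in> K1" for a b
    using that Suc.prems(2) unfolding K1_def root_def by fastforce
  have ratD: "(\<forall>i<n. a i \<in> \<rat>) \<and> b \<in> \<rat>" if "(a, b) \<in> D" for a b
    using that ratK1 unfolding D_def by fastforce
  obtain q where q: "\<forall>i<n. q i \<in> \<rat>"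
    and sg: "\<forall>(a, b)\<in>{(a, b) \<in> K. a n = 0} \<union> D. sgn (val (a, b) q) = sgn (val (a, b) x)"
  proof -
    have "finite ({(a, b) \<in> K. a n = 0} \<union> D)"
      using Suc.prems(1) finK1 by (auto simp: D_def intro: rev_finite_subset)
    moreover have "\<And>a b. (a, b) \<in> {(a, b) \<in> K. a n = 0} \<union> D \<Longrightarrow> (\<forall>i<n. a i \<in> \<rat>) \<and> b \<in> \<rat>"
      using ratD Suc.prems(2) by fastforce
    ultimately show ?thesis using Suc.IH[of "{(a, b) \<in> K. a n = 0} \<union> D"] that
      unfolding val_def by auto
  qed
  have cmp: "sgn (val r q - val s q) = sgn (val r x - val s x)" if "r \<in> K1" "s \<in> K1" for r s
  proof -
    obtain a b a' b' where rs: "r = (a, b)" "s = (a', b')" by (cases r, cases s)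
    have "(\<lambda>i. a i - a' i, b - b') \<in> D"
      unfolding D_def using that rs by force
    moreover have "val (\<lambda>i. a i - a' i, b - b') y = val r y - val s y" for y
      unfolding val_def rs by (simp add: left_diff_distrib sum_subtractf)
    moreover have "sgn (val (\<lambda>i. a i - a' i, b - b') q) = sgn (val (\<lambda>i. a i - a' i, b - b') x)"
      using bspec[OF sg, of "(\<lambda>i. a i - a' i, b - b')"] calculation(1) by simp
    ultimately show ?thesis by simp
  qed
  have ratval: "val r q \<in> \<rat>" if "r \<in> K1" for r
  proof -
    obtain a b where r: "r = (a, b)" by (cases r)
    have "(\<Sum>i<n. a i * q i) \<in> \<rat>" using ratK1 that q r by (intro Rats_sum) auto
    then show ?thesis using ratK1 that r by (auto simp: val_def)
  qed
  obtain t where t: "t \<in> \<rat>" and st: "\<And>r. r \<in> K1 \<Longrightarrow> sgn (t - val r q) = sgn (x n - val r x)"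
  proof (cases "\<exists>r\<in>K1. val r x = x n")
    case True
    then obtain r where "r \<in> K1" "val r x = x n" by blast
    then show ?thesis using that[of "val r q"] ratval cmp[of r] by simp
  next
    case False
    define L where "L = {r \<in> K1. val r x < x n}"
    define U where "U = {r \<in> K1. x n < val r x}"
    have fin: "finite L" "finite U" unfolding L_def U_def using finK1 by auto
    have K1: "K1 = L \<union> U" unfolding L_def U_def using False by force
    have less: "val r q < val s q" if "r \<in> L" "s \<in> U" for r s
    proof -
      have "sgn (val r q - val s q) = sgn (val r x - val s x)" 
        using cmp that unfolding L_def U_def by blast
      moreover have "val r x - val s x < 0" using that unfolding L_def U_def by force
      ultimately show ?thesis by (simp add: sgn_if split: if_splits)
    qed
    have "\<exists>t\<in>\<rat>. (\<forall>a\<in>(\<lambda>r. val r q) ` L. a < t) \<and> (\<forall>b\<in>(\<lambda>s. val s q) ` U. t < b)"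
      using fin less by (intro rational_between_finite_sets) auto
    then obtain t where "t \<in> \<rat>" and t: "\<And>r. r \<in> L \<Longrightarrow> val r q < t" "\<And>s. s \<in> U \<Longrightarrow> t < val s q" by auto
    have "sgn (t - val r q) = sgn (x n - val r x)" if "r \<in> K1" for r
      using that t[of r] unfolding K1 by (auto simp: L_def U_def sgn_if)
    then show ?thesis using that \<open>t \<in> \<rat>\<close> by blast
  qed
  have "sgn ((\<Sum>i<Suc n. a i * (q(n := t)) i) + b) = sgn ((\<Sum>i<Suc n. a i * x i) + b)" if "(a, b) \<in> K" for a b
  proof (cases "a n = 0")
    case True
    then show ?thesis using sg that by (auto simp: val_def)
  next
    case False
    define r where "r = root (a, b)"
    have "r \<in> K1" using that False unfolding r_def K1_def by auto
    have *: "(\<Sum>i<Suc n. a i * y i) + b = a n * (y n - val r y)" for y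
      using False by (simp add: r_def root_def val_def algebra_simps sum_negf sum_divide_distrib[symmetric])
    have "val r (q(n := t)) = val r q" by (simp add: val_def split_beta)
    then show ?thesis using st[OF \<open>r \<in> K1\<close>] unfolding * by (simp add: sgn_mult del: fun_upd_apply) simp
  qed
  then show ?case using q t by (intro exI[of _ "q(n := t)"]) (auto simp: less_Suc_eq)
qed

lemma rational_point_same_signs:
  assumes "finite H" "\<And>h. h \<in> H \<Longrightarrow> rational_form n h" 
  obtains q where "q \<in> Rspace n" "\<forall>i<n. Poly_Mapping.lookup q i \<in> \<rat>" "\<forall>h\<in>H. sgn (h q) = sgn (h x)"
proof -
  have "\<forall>h\<in>H. \<exists>a b. (\<forall>i<n. a i \<in> \<rat>) \<and> b \<in> \<rat> \<and> h = (\<lambda>x. (\<Sum>i<n. a i * Poly_Mapping.lookup x i) + b)"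
    using assms(2) unfolding affine_form_def by blast
  then obtain a b where ab: "\<forall>h\<in>H. (\<forall>i<n. a h i \<in> \<rat>) \<and> b h \<in> \<rat> \<and>
      h = (\<lambda>x. (\<Sum>i<n. a h i * Poly_Mapping.lookup x i) + b h)" by metis
  obtain q where q: "\<forall>i<n. q i \<in> \<rat>" 
    "\<forall>(a, b)\<in>(\<lambda>h. (a h, b h)) ` H. sgn ((\<Sum>i<n. a i * q i) + b) = sgn ((\<Sum>i<n. a i * Poly_Mapping.lookup x i) + b)"
    using rational_coordinates_same_signs[of "(\<lambda>h. (a h, b h)) ` H" n "Poly_Mapping.lookup x"] assms(1) ab by auto
  have "sgn (h (point_of n q)) = sgn (h x)" if "h \<in> H" for h
  proof -
    have "sgn ((\<Sum>i<n. a h i * q i) + b h) = sgn ((\<Sum>i<n. a h i * Poly_Mapping.lookup x i) + b h)"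
      using q(2) that by auto
    moreover have "h y = (\<Sum>i<n. a h i * Poly_Mapping.lookup y i) + b h" for y
      using ab that by metis
    ultimately show ?thesis by simp
  qed
  then show ?thesis using that[of "point_of n q"] q(1) by auto
qed

section \<open>Cells of a hyperplane arrangement\<close>

text \<open>
  For a finite set of affine forms the points with the same signs as \<open>y\<close> are a relatively open cell,
  and the points below \<open>y\<close> in the following preorder are its closure.
\<close>

definition le_sign :: "(point \<Rightarrow> real) set \<Rightarrow> point \<Rightarrow> point \<Rightarrow> bool" where
  "le_sign H x y \<longleftrightarrow> (\<forall>h\<in>H. h x = 0 \<or> sgn (h x) = sgn (h y))"

definition same_sign :: "(point \<Rightarrow> real) set \<Rightarrow> point \<Rightarrow> point \<Rightarrow> bool" where
  "same_sign H x y \<longleftrightarrow> (\<forall>h\<in>H. sgn (h x) = sgn (h y))"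

lemma le_sign_refl: "le_sign H x x"
  by (simp add: le_sign_def)

lemma le_sign_trans: "le_sign H x y \<Longrightarrow> le_sign H y z \<Longrightarrow> le_sign H x z"
  unfolding le_sign_def by (metis sgn_0_0)

lemma same_sign_sym: "same_sign H x y \<Longrightarrow> same_sign H y x"
  by (simp add: same_sign_def)

lemma same_sign_trans: "same_sign H x y \<Longrightarrow> same_sign H y z \<Longrightarrow> same_sign H x z"
  by (simp add: same_sign_def)

lemma same_sign_le: "same_sign H x y \<Longrightarrow> le_sign H x y"
  by (simp add: same_sign_def le_sign_def)

lemma convex_le_sign:
  assumes "\<And>h. h \<in> H \<Longrightarrow> affine_form K n h"
  shows "convex {x. le_sign H x c}"
proof (rule convexI, clarsimp simp: le_sign_def)
  fix x y h and u v :: real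
  assume *: "\<forall>h\<in>H. h x = 0 \<or> sgn (h x) = sgn (h c)" "\<forall>h\<in>H. h y = 0 \<or> sgn (h y) = sgn (h c)"
    "0 \<le> u" "0 \<le> v" "u + v = 1" "h \<in> H" "sgn (h (u *\<^sub>R x + v *\<^sub>R y)) \<noteq> sgn (h c)"
  have eq: "h (u *\<^sub>R x + v *\<^sub>R y) = u * h x + v * h y"
    using affine_form_segment[OF assms[OF \<open>h \<in> H\<close>] \<open>u + v = 1\<close>] .
  have "h x = 0 \<or> sgn (h x) = sgn (h c)" "h y = 0 \<or> sgn (h y) = sgn (h c)" using * by auto
  then consider "h c = 0" "h x = 0" "h y = 0" | "h c > 0" "h x \<ge> 0" "h y \<ge> 0" | "h c < 0" "h x \<le> 0" "h y \<le> 0"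
    by (auto simp: sgn_if split: if_splits)
  then show "h (u *\<^sub>R x + v *\<^sub>R y) = 0"
  proof cases
    case 1
    then show ?thesis by (simp add: eq)
  next
    case 2
    then have "h (u *\<^sub>R x + v *\<^sub>R y) \<ge> 0" using * by (simp add: eq)
    then show ?thesis using *(7) 2 by (auto simp: sgn_if split: if_splits)
  next
    case 3
    then have "u * h x + v * h y \<le> 0" using * by (simp add: add_nonpos_nonpos mult_nonneg_nonpos)
    then show ?thesis using *(7) 3 by (auto simp: eq sgn_if split: if_splits)
  qed
qed

lemma segment_same_sign:
  assumes "\<And>h. h \<in> H \<Longrightarrow> affine_form K n h" "le_sign H y c" "0 \<le> s" "0 < t" "s + t = 1"
  shows "same_sign H (s *\<^sub>R y + t *\<^sub>R c) c"
  unfolding same_sign_def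
proof
  fix h assume h: "h \<in> H"
  have eq: "h (s *\<^sub>R y + t *\<^sub>R c) = s * h y + t * h c"
    using affine_form_segment[OF assms(1)[OF h] assms(5)] .
  consider "h c = 0" "h y = 0" | "h c > 0" "h y \<ge> 0" | "h c < 0" "h y \<le> 0"
    using assms(2) h by (fastforce simp: le_sign_def sgn_if split: if_splits)
  then show "sgn (h (s *\<^sub>R y + t *\<^sub>R c)) = sgn (h c)"
  proof cases
    case 1
    then show ?thesis by (simp add: eq)
  next
    case 2
    then have "s * h y + t * h c > 0" using assms by (simp add: add_nonneg_pos)
    then show ?thesis using 2 by (simp add: eq)
  next
    case 3
    then have "s * h y + t * h c < 0" 
      using assms by (simp add: add_nonpos_neg mult_nonneg_nonpos mult_pos_neg)
    then show ?thesis using 3 by (simp add: eq)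
  qed
qed

text \<open>
  Two points \<open>y\<close>, \<open>y'\<close> that lie on one ray from \<open>c\<close> (both give the same point when mixed with \<open>c\<close>): the
  one that is mixed with less of \<open>c\<close> is nearer to \<open>c\<close>. It is itself a mixture of the other with a
  positive amount of \<open>c\<close>, hence in the open cell of \<open>c\<close>.
\<close>

lemma overshooting_same_sign:
  assumes forms: "\<And>h. h \<in> H \<Longrightarrow> affine_form K n h" and "le_sign H y' c"
    and "s + t = 1" "s' + t' = 1" "0 < s" "0 \<le> s'" "t < t'"
    and eq: "s *\<^sub>R y + t *\<^sub>R c = s' *\<^sub>R y' + t' *\<^sub>R c"
  shows "same_sign H y c"
proof -
  have "s *\<^sub>R y = s' *\<^sub>R y' + (t' - t) *\<^sub>R c" using eq by (simp add: algebra_simps)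
  then have "(1/s) *\<^sub>R (s *\<^sub>R y) = (1/s) *\<^sub>R (s' *\<^sub>R y' + (t' - t) *\<^sub>R c)" by simp
  then have "y = (s'/s) *\<^sub>R y' + ((t' - t)/s) *\<^sub>R c" using \<open>0 < s\<close> by (simp add: scaleR_add_right)
  moreover have "s'/s + (t' - t)/s = 1" using assms by (simp add: field_simps)
  ultimately show ?thesis
    using segment_same_sign[OF forms \<open>le_sign H y' c\<close>, of "s'/s" "(t' - t)/s"] assms(5-7) by simp
qed

lemma convex_hull_split_point:
  assumes "x \<in> convex hull (insert c C)"
  obtains "x = c" | y s t where "y \<in> convex hull C" "0 \<le> s" "0 \<le> t" "s + t = 1" "x = s *\<^sub>R y + t *\<^sub>R c"
proof (cases "C = {}")
  case True
  then show ?thesis using assms that by simp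
next
  case False
  then show ?thesis using assms that(2) unfolding convex_hull_insert[OF False]
    by (smt (verit) add.commute mem_Collect_eq)
qed

section \<open>Simplexes and their faces in real vector spaces\<close>

lemma affine_independent_insert_point:
  fixes C :: "'a::real_vector set"
  assumes "finite C" "\<not> affine_dependent C" "c \<notin> affine hull C"
  shows "\<not> affine_dependent (insert c C)"
proof
  have c: "c \<notin> C" using assms(3) hull_inc[of c C affine] by blast
  assume "affine_dependent (insert c C)"
  then obtain U where U: "sum U (insert c C) = 0" "\<exists>v\<in>insert c C. U v \<noteq> 0"
    "(\<Sum>v\<in>insert c C. U v *\<^sub>R v) = 0"
    using assms(1) affine_dependent_explicit_finite[of "insert c C"] by blast
  show False
  proof (cases "U c = 0")
    case True
    then have "affine_dependent C"
      using U c assms(1) unfolding affine_dependent_explicit_finite[OF assms(1)]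
      by (intro exI[of _ U]) auto
    then show False using assms(2) by blast
  next
    case False
    have "sum (\<lambda>v. - U v / U c) C = - sum U C / U c" by (simp add: sum_divide_distrib sum_negf)
    also have "\<dots> = 1" using U(1) c assms(1) False by (simp add: field_simps)
    finally have 1: "sum (\<lambda>v. - U v / U c) C = 1" .
    have "(\<Sum>v\<in>C. (- U v / U c) *\<^sub>R v) = (- 1 / U c) *\<^sub>R (\<Sum>v\<in>C. U v *\<^sub>R v)"
      by (simp add: scaleR_sum_right)
    also have "(\<Sum>v\<in>C. U v *\<^sub>R v) = - (U c *\<^sub>R c)" 
      using U(3) c assms(1) by (simp add: add_eq_0_iff)
    finally have "(\<Sum>v\<in>C. (- U v / U c) *\<^sub>R v) = c" using False by simp
    then have "c \<in> affine hull C" using 1 unfolding affine_hull_finite[OF assms(1)] by blast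
    then show False using assms(3) by blast
  qed
qed

text \<open>
  Removing one vertex of a simplex leaves a face, since the vertex is outside the affine hull of the
  others; faces of faces are faces.
\<close>

lemma face_of_simplex_subset:
  fixes V :: "'a::real_vector set"
  assumes "finite V" "\<not> affine_dependent V" "W \<subseteq> V"
  shows "convex hull W face_of convex hull V"
  using assms
proof (induction "card (V - W)" arbitrary: V)
  case 0
  then have "V = W" by auto
  then show ?case by (simp add: face_of_refl)
next
  case (Suc k)
  then obtain c where c: "c \<in> V" "c \<notin> W" by (metis card.empty Diff_eq_empty_iff nat.simps(3) subsetI)
  have "card (V - {c} - W) = k"
    using Suc.hyps(2) Suc.prems(1) c by (metis Diff_iff Diff_insert Diff_insert2 card_Diff_singleton diff_Suc_1)
  moreover have "\<not> affine_dependent (V - {c})"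
    using Suc.prems(2) affine_dependent_subset by blast
  ultimately have 1: "convex hull W face_of convex hull (V - {c})"
    using Suc.hyps(1)[of "V - {c}"] Suc.prems c by blast
  have "c \<notin> affine hull (V - {c})" using Suc.prems(2) c unfolding affine_dependent_def by blast
  moreover have "V - (V - {c}) = {c}" using c by auto
  ultimately have "affine hull (V - {c}) \<inter> convex hull (V - (V - {c})) = {}" by simp
  then have "convex hull (V - {c}) face_of convex hull V"
    using Suc.prems(1) by (intro face_of_convex_hulls) auto
  then show ?case using 1 face_of_trans by blast
qed

text \<open>
  A vertex that has positive weight in a convex combination is an end point of a segment through the
  combined point, so a face containing the point contains the vertex.
\<close>

lemma face_of_convex_hull_finite:
  fixes V :: "'a::real_vector set"
  assumes "finite V" "F face_of convex hull V"
  shows "F = convex hull (V \<inter> F)"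
proof
  show "convex hull (V \<inter> F) \<subseteq> F"
    using assms(2) by (intro hull_minimal) (auto simp: face_of_def)
  show "F \<subseteq> convex hull (V \<inter> F)"
  proof
    fix x assume x: "x \<in> F"
    then have "x \<in> convex hull V" using assms(2) face_of_imp_subset by blast
    then obtain u where u: "\<forall>v\<in>V. 0 \<le> u v" "sum u V = 1" "(\<Sum>v\<in>V. u v *\<^sub>R v) = x"
      unfolding convex_hull_finite[OF assms(1)] by auto
    have inF: "v \<in> F" if v: "v \<in> V" "u v \<noteq> 0" for v
    proof (cases "u v = 1")
      case True
      then have "sum u (V - {v}) = 0" using u(2) v assms(1) by (simp add: sum_diff1)
      then have "\<forall>w\<in>V - {v}. u w = 0" using u(1) assms(1) by (subst (asm) sum_nonneg_eq_0_iff) auto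
      then have "x = (\<Sum>w\<in>{v}. u w *\<^sub>R w)" unfolding u(3)[symmetric] 
        using v assms(1) by (intro sum.mono_neutral_right) auto
      then show ?thesis using x True by simp
    next
      case False
      define r where "r = 1 - u v"
      have sr: "sum u (V - {v}) = r" using u(2) v assms(1) by (simp add: sum_diff1 r_def)
      have "r \<ge> 0" using u(1) unfolding sr[symmetric] by (intro sum_nonneg) auto
      then have r: "r > 0" using False by (simp add: r_def)
      define y where "y = (\<Sum>w\<in>V - {v}. (u w / r) *\<^sub>R w)"
      have "sum (\<lambda>w. u w / r) (V - {v}) = 1" using sr r by (simp flip: sum_divide_distrib)
      then have y: "y \<in> convex hull V" unfolding y_def using assms(1) u(1) r
        by (intro convex_sum) (auto simp: hull_inc)
      have "r *\<^sub>R y = (\<Sum>w\<in>V - {v}. u w *\<^sub>R w)" using r by (simp add: y_def scaleR_sum_right)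
      then have eq: "x = u v *\<^sub>R v + (1 - u v) *\<^sub>R y" 
        using u(3) v assms(1) by (simp add: r_def sum.remove[of V v])
      show ?thesis
      proof (cases "y = v")
        case True
        then have "x = v" using eq by (simp flip: scaleR_add_left)
        then show ?thesis using x by simp
      next
        case ne: False
        have "x \<in> open_segment y v" unfolding in_segment
          using ne eq u(1) v r by (intro conjI exI[of _ "u v"]) (auto simp: r_def order_less_le)
        then show ?thesis using face_ofD[OF assms(2), of x y v] x y v(1) hull_inc[of v V convex] by blast
      qed
    qed
    have 1: "(\<Sum>v\<in>V \<inter> F. u v *\<^sub>R v) = x" unfolding u(3)[symmetric]
      using assms(1) inF by (intro sum.mono_neutral_left) auto
    have 2: "sum u (V \<inter> F) = 1" unfolding u(2)[symmetric]
      using assms(1) inF by (intro sum.mono_neutral_left) auto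
    show "x \<in> convex hull (V \<inter> F)"
      using convex_sum[of "V \<inter> F" "convex hull (V \<inter> F)" u "\<lambda>v. v"] 1 2 u(1) assms(1) by (auto simp: hull_inc)
  qed
qed

section \<open>The barycentric subdivision of the cells\<close>

text \<open>
  \<open>P\<close> is a bounded union of closed cells of the arrangement \<open>H\<close>, and \<open>W\<close> contains exactly one rational
  point, the barycentre, from each open cell that meets \<open>P\<close>.
\<close>

locale sign_cells =
  fixes n :: nat and H :: "(point \<Rightarrow> real) set" and P W :: "point set"
  assumes finite_H: "finite H" and forms: "h \<in> H \<Longrightarrow> rational_form n h"
    and finite_W: "finite W" and W_subset: "W \<subseteq> P" and P_subset: "P \<subseteq> Rspace n"
    and separated: "\<lbrakk>w \<in> W; w' \<in> W; same_sign H w w'\<rbrakk> \<Longrightarrow> w = w'"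
    and represented: "x \<in> P \<Longrightarrow> \<exists>w\<in>W. same_sign H x w"
    and downward: "\<lbrakk>y \<in> P; x \<in> Rspace n; le_sign H x y\<rbrakk> \<Longrightarrow> x \<in> P"
    and bounded: "\<exists>B. \<forall>x\<in>P. \<forall>i<n. \<bar>Poly_Mapping.lookup x i\<bar> \<le> B"
    and rational: "\<lbrakk>w \<in> W; i < n\<rbrakk> \<Longrightarrow> Poly_Mapping.lookup w i \<in> \<rat>"
begin

definition chain :: "point set \<Rightarrow> bool" where
  "chain C \<longleftrightarrow> C \<subseteq> W \<and> (\<forall>x\<in>C. \<forall>y\<in>C. le_sign H x y \<or> le_sign H y x)"

lemma finite_chain: "chain C \<Longrightarrow> finite C"
  unfolding chain_def using finite_W finite_subset by blast

lemma chain_subset: "chain C \<Longrightarrow> D \<subseteq> C \<Longrightarrow> chain D"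
  unfolding chain_def by blast

lemma chain_top:
  assumes "chain C" "C \<noteq> {}"
  obtains c where "c \<in> C" "\<And>v. v \<in> C \<Longrightarrow> le_sign H v c"
proof -
  have "\<exists>c\<in>C. \<forall>v\<in>C. le_sign H v c"
    using finite_chain[OF assms(1)] assms(2,1)
  proof (induction rule: finite_ne_induct)
    case (singleton x)
    then show ?case by (simp add: le_sign_refl)
  next
    case (insert x C)
    then obtain c where c: "c \<in> C" "\<forall>v\<in>C. le_sign H v c"
      using chain_subset[of "insert x C" C] by blast
    have "le_sign H x c \<or> le_sign H c x" using insert.prems c(1) unfolding chain_def by blast
    then show ?case using c le_sign_trans le_sign_refl by (metis insert_iff)
  qed
  then show ?thesis using that by blast
qed

lemma hull_le_top:
  assumes "\<And>v. v \<in> C \<Longrightarrow> le_sign H v c" "x \<in> convex hull C"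
  shows "le_sign H x c"
proof -
  have "convex hull C \<subseteq> {x. le_sign H x c}"
    using assms(1) convex_le_sign[of H \<rat> n c] forms by (intro hull_minimal) auto
  then show ?thesis using assms(2) by blast
qed

text \<open>
  A point with positive weight on the top vertex lies in the open cell of the top vertex.
\<close>

lemma hull_top_sign:
  assumes "c \<in> C" "\<And>v. v \<in> C \<Longrightarrow> le_sign H v c" "x \<in> convex hull C" "x \<notin> convex hull (C - {c})"
  shows "same_sign H x c"
proof -
  have "x \<in> convex hull (insert c (C - {c}))" using assms by (simp add: insert_absorb)
  then show ?thesis
  proof (cases rule: convex_hull_split_point)
    case (2 y s t)
    then have "t \<noteq> 0" using assms(4) by auto
    moreover have "le_sign H y c" using hull_le_top[OF _ 2(1)] assms(2) by blast
    ultimately show ?thesis using segment_same_sign[of H \<rat> n y c s t] forms 2 by auto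
  qed (simp add: same_sign_def)
qed

lemma hull_same_sign:
  assumes "chain C" "x \<in> convex hull C"
  shows "\<exists>v\<in>C. same_sign H x v"
  using assms
proof (induction "card C" arbitrary: C)
  case 0
  then show ?case using finite_chain by fastforce
next
  case (Suc k)
  then have "C \<noteq> {}" by auto
  then obtain c where c: "c \<in> C" "\<And>v. v \<in> C \<Longrightarrow> le_sign H v c" using chain_top Suc.prems by metis
  show ?case
  proof (cases "x \<in> convex hull (C - {c})")
    case True
    moreover have "k = card (C - {c})" using Suc.hyps(2) c(1) by simp
    ultimately show ?thesis using Suc.hyps(1)[of "C - {c}"] Suc.prems chain_subset by blast
  next
    case False
    then show ?thesis using hull_top_sign[OF c Suc.prems(2)] c(1) by blast
  qed
qed

text \<open>
  Uniqueness of barycentric coordinates across all chains. If neither top vertex can be dropped, the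
  point lies in the open cells of both tops, which therefore coincide in a vertex \<open>c\<close>. The two
  representations mix \<open>c\<close> with points of lower cells on the same ray from \<open>c\<close>; if the weights of \<open>c\<close>
  differed, one of these points would lie in the cell of \<open>c\<close> itself. So the weights and the points
  agree, and the induction hypothesis applies to these points.
\<close>

lemma hull_inter_subset:
  assumes "chain C" "chain D" "x \<in> convex hull C" "x \<in> convex hull D"
  shows "x \<in> convex hull (C \<inter> D)"
  using assms
proof (induction "card C + card D" arbitrary: C D x rule: less_induct)
  case less
  have "C \<noteq> {}" "D \<noteq> {}" using less.prems by auto
  then obtain c d where c: "c \<in> C" "\<And>v. v \<in> C \<Longrightarrow> le_sign H v c" 
    and d: "d \<in> D" "\<And>v. v \<in> D \<Longrightarrow> le_sign H v d" using chain_top less.prems by metis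
  have xC: "x \<in> convex hull (insert c (C - {c}))" using less.prems c by (simp add: insert_absorb)
  have xD: "x \<in> convex hull (insert d (D - {d}))" using less.prems d by (simp add: insert_absorb)
  have cardC: "card (C - {c}) < card C" using c less.prems finite_chain by (meson card_Diff1_less)
  have cardD: "card (D - {d}) < card D" using d less.prems finite_chain by (meson card_Diff1_less)
  have cW: "c \<in> W" "d \<in> W" using c d less.prems by (auto simp: chain_def)
  have sub: "convex hull ((C - {c}) \<inter> D) \<subseteq> convex hull (C \<inter> D)" 
    "convex hull (C \<inter> (D - {d})) \<subseteq> convex hull (C \<inter> D)" by (rule hull_mono, blast)+
  show ?case
  proof (cases "x \<in> convex hull (C - {c})")
    case True
    then show ?thesis using less.hyps[of "C - {c}" D x] cardC less.prems chain_subset sub(1) by fastforce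
  next
    case xnC: False
    show ?thesis
    proof (cases "x \<in> convex hull (D - {d})")
      case True
      then show ?thesis using less.hyps[of C "D - {d}" x] cardD less.prems chain_subset sub(2) by fastforce
    next
      case xnD: False
      have sc: "same_sign H x c" and sd: "same_sign H x d"
        using hull_top_sign[OF c _ xnC] hull_top_sign[OF d _ xnD] less.prems by blast+
      have cd: "c = d" using separated[OF cW] sc sd same_sign_sym same_sign_trans by blast
      have low: "\<not> same_sign H y c" if E: "y \<in> convex hull (E - {c})" "chain E" "c \<in> E" for y E
      proof
        assume "same_sign H y c"
        moreover obtain v where "v \<in> E - {c}" "same_sign H y v" 
          using hull_same_sign[of "E - {c}" y] E chain_subset by blast
        ultimately have "v = c" using separated E(2) cW(1) same_sign_sym same_sign_trans
          unfolding chain_def by blast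
        then show False using \<open>v \<in> E - {c}\<close> by blast
      qed
      have parallel: "t = t'" if y: "y \<in> convex hull (C - {c})" "y' \<in> convex hull (D - {c})"
        and st: "s + t = 1" "s' + t' = 1" "0 < s" "0 < s'"
        and eq: "s *\<^sub>R y + t *\<^sub>R c = s' *\<^sub>R y' + t' *\<^sub>R c" for y y' s s' t t'
      proof (cases t t' rule: linorder_cases)
        case lt: less
        have "le_sign H y' c" using hull_le_top[OF _ y(2)] d(2) cd by blast
        then have "same_sign H y c"
          using overshooting_same_sign[of H \<rat> n y' c s t s' t' y] forms st eq lt by simp
        then show ?thesis using low[OF y(1) less.prems(1) c(1)] by blast
      next
        case greater
        have "le_sign H y c" using hull_le_top[OF _ y(1)] c(2) by blast
        then have "same_sign H y' c"
          using overshooting_same_sign[of H \<rat> n y c s' t' s t y'] forms st eq greater by simp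
        then show ?thesis using low[OF y(2) less.prems(2)] d(1) cd by blast
      qed
      have cCD: "c \<in> convex hull (C \<inter> D)" using c d cd by (simp add: hull_inc)
      show ?thesis
        using xC
      proof (cases rule: convex_hull_split_point)
        case 1
        then show ?thesis using cCD by simp
      next
        case C: (2 y s t)
        show ?thesis
          using xD
        proof (cases rule: convex_hull_split_point)
          case 1
          then show ?thesis using cCD cd by simp
        next
          case D: (2 y' s' t')
          show ?thesis
          proof (cases "s = 0 \<or> s' = 0")
            case True
            then have "x = c" using C D cd by auto
            then show ?thesis using cCD by simp
          next
            case False
            then have "0 < s" "0 < s'" using C(2) D(2) by auto
            then have t: "t = t'" using parallel[OF C(1)] C D cd by metis
            then have s: "s = s'" using C D by simp
            have "s *\<^sub>R y + t *\<^sub>R c = s *\<^sub>R y' + t *\<^sub>R c" using C(5) D(5) cd s t by metis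
            then have "y = y'" using False by simp
            then have "y \<in> convex hull ((C - {c}) \<inter> (D - {c}))"
              using less.hyps[of "C - {c}" "D - {c}" y] cardC cardD C(1) D(1) cd less.prems chain_subset by auto
            then have "y \<in> convex hull (C \<inter> D)" using hull_mono[of "(C - {c}) \<inter> (D - {c})" "C \<inter> D"] by blast
            then show ?thesis using cCD C convexD[OF convex_convex_hull] by blast
          qed
        qed
      qed
    qed
  qed
qed

text \<open>
  Some form vanishes on all lower cells of the chain but not at the top vertex, because a cell that is
  properly below another one differs from it only by having more zeros.
\<close>

lemma chain_affine_independent:
  assumes "chain C"
  shows "\<not> affine_dependent C"
  using assms
proof (induction "card C" arbitrary: C)
  case 0
  then have "C = {}" using finite_chain by simp
  then show ?case by simp
next
  case (Suc k)
  then have "C \<noteq> {}" by auto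
  then obtain c where c: "c \<in> C" "\<And>v. v \<in> C \<Longrightarrow> le_sign H v c" using chain_top Suc.prems by metis
  define C' where "C' = C - {c}"
  have chC': "chain C'" using Suc.prems chain_subset unfolding C'_def by blast
  have ind: "\<not> affine_dependent C'" using Suc.hyps chC' c unfolding C'_def by simp
  have "c \<notin> affine hull C'"
  proof (cases "C' = {}")
    case False
    then obtain c' where c': "c' \<in> C'" "\<And>v. v \<in> C' \<Longrightarrow> le_sign H v c'" using chain_top chC' by metis
    have "\<not> same_sign H c' c" using separated[of c' c] c' c Suc.prems unfolding C'_def chain_def by auto
    then obtain h where h: "h \<in> H" "sgn (h c') \<noteq> sgn (h c)" unfolding same_sign_def by blast
    then have h0: "h c' = 0" using c(2)[of c'] c'(1) unfolding C'_def le_sign_def by blast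
    then have hc: "h c \<noteq> 0" using h by auto
    have "\<forall>v\<in>C'. h v = 0" using c'(2) h(1) h0 unfolding le_sign_def by (metis sgn_0_0)
    moreover have "affine {x. h x = 0}"
      unfolding affine_def using affine_form_segment[OF forms[OF h(1)]] by simp
    ultimately have "affine hull C' \<subseteq> {x. h x = 0}" by (intro hull_minimal) auto
    then show ?thesis using hc by blast
  qed simp
  then have "\<not> affine_dependent (insert c C')"
    using affine_independent_insert_point ind finite_chain[OF chC'] by blast
  then show ?case using c by (simp add: C'_def insert_absorb)
qed

text \<open>
  Follow the ray from the barycentre \<open>w\<close> of the open cell of \<open>x\<close> through \<open>x\<close> until it leaves the closed
  cell, which happens since \<open>P\<close> is bounded. At the exit point one more form vanishes, so by
  induction it lies in a simplex of lower barycentres, and \<open>x\<close> is between it and \<open>w\<close>.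
\<close>

lemma point_in_chain_hull:
  assumes "x \<in> P"
  shows "\<exists>C. chain C \<and> (\<forall>v\<in>C. le_sign H v x) \<and> x \<in> convex hull C"
  using assms
proof (induction "card {h \<in> H. h x \<noteq> 0}" arbitrary: x rule: less_induct)
  case less
  obtain w where w: "w \<in> W" "same_sign H x w" using represented less.prems by blast
  have sg: "sgn (h x) = sgn (h w)" if "h \<in> H" for h using w that by (simp add: same_sign_def)
  show ?case
  proof (cases "x = w")
    case True
    then show ?thesis using w by (intro exI[of _ "{w}"]) (auto simp: chain_def le_sign_refl)
  next
    case False
    define z where "z t = (1 - t) *\<^sub>R w + t *\<^sub>R x" for t :: real
    have hz: "h (z t) = (1 - t) * h w + t * h x" if "h \<in> H" for h t
      unfolding z_def by (rule affine_form_segment[OF forms[OF that]]) simp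
    have wR: "w \<in> Rspace n" "x \<in> Rspace n" using w less.prems W_subset P_subset by auto
    have zR: "z t \<in> Rspace n" for t using wR by (auto simp: Rspace_iff z_def lookup_add)
    \<comment> \<open>the forms that tend to 0 along the ray, and the parameter at which each of them vanishes\<close>
    define N where "N = {h \<in> H. \<bar>h x\<bar> < \<bar>h w\<bar>}"
    define r where "r h = \<bar>h w\<bar> / (\<bar>h w\<bar> - \<bar>h x\<bar>)" for h :: "point \<Rightarrow> real"
    have le: "le_sign H (z t) w" if "1 \<le> t" "\<And>h. h \<in> N \<Longrightarrow> t \<le> r h" for t
      unfolding le_sign_def
    proof
      fix h assume h: "h \<in> H"
      define p where "p = \<bar>h w\<bar>"
      define q where "q = \<bar>h x\<bar>"
      have pq: "(1 - t) * p + t * q \<ge> 0"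
      proof (cases "q < p")
        case True
        then have "t \<le> p / (p - q)" using that(2)[of h] h by (simp add: N_def r_def p_def q_def)
        then have "t * (p - q) \<le> p" using True by (simp add: pos_le_divide_eq)
        then show ?thesis by (simp add: algebra_simps)
      next
        case False
        then have "t * p \<le> t * q" using that(1) by (intro mult_left_mono) auto
        moreover have "p \<ge> 0" by (simp add: p_def)
        ultimately show ?thesis by (simp add: algebra_simps)
      qed
      have "h w = sgn (h w) * p" "h x = sgn (h w) * q"
        using sg[OF h] by (simp_all add: p_def q_def sgn_mult_abs) (metis mult_sgn_abs)
      then have "h (z t) = sgn (h w) * ((1 - t) * p + t * q)"
        unfolding hz[OF h] by (metis distrib_left mult.left_commute)
      then show "h (z t) = 0 \<or> sgn (h (z t)) = sgn (h w)"
        using pq by (auto simp: sgn_mult sgn_if)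
    qed
    \<comment> \<open>otherwise the whole ray would stay in the closed cell, contradicting boundedness\<close>
    have "N \<noteq> {}"
    proof
      assume "N = {}"
      obtain B where B: "\<forall>x\<in>P. \<forall>i<n. \<bar>Poly_Mapping.lookup x i\<bar> \<le> B" using bounded by blast
      obtain i where i: "i < n" "Poly_Mapping.lookup x i \<noteq> Poly_Mapping.lookup w i" 
        using False Rspace_eqI wR by metis
      define a where "a = Poly_Mapping.lookup w i"
      define d where "d = Poly_Mapping.lookup x i - a"
      have d: "d \<noteq> 0" using i by (simp add: d_def a_def)
      have "\<bar>a + t * d\<bar> \<le> B" if "1 \<le> t" for t
      proof -
        have "z t \<in> P" using downward[OF _ zR le] that w(1) W_subset \<open>N = {}\<close> by blast
        moreover have "Poly_Mapping.lookup (z t) i = a + t * d"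
          by (simp add: z_def lookup_add a_def d_def) (simp add: algebra_simps)
        ultimately show ?thesis using B i(1) by metis
      qed
      note bd = this
      define t where "t = 1 + (\<bar>a\<bar> + \<bar>B\<bar> + 1) / \<bar>d\<bar>"
      have "t * \<bar>d\<bar> = \<bar>d\<bar> + (\<bar>a\<bar> + \<bar>B\<bar> + 1)" using d by (simp add: t_def field_simps)
      moreover have "t \<ge> 1" by (simp add: t_def)
      moreover have "\<bar>t * d\<bar> = t * \<bar>d\<bar>" using \<open>t \<ge> 1\<close> by (simp add: abs_mult)
      ultimately show False using bd[of t] by linarith
    qed
    define t where "t = Min (r ` N)"
    have fN: "finite N" using finite_H by (simp add: N_def)
    have r1: "1 < r h" if "h \<in> N" for h
    proof -
      have "h x \<noteq> 0" using sg[of h] that by (auto simp: N_def sgn_if split: if_splits)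
      then show ?thesis using that by (simp add: N_def r_def field_simps)
    qed
    have t1: "1 < t" unfolding t_def using fN \<open>N \<noteq> {}\<close> r1 by simp
    have tr: "t \<le> r h" if "h \<in> N" for h using that fN by (simp add: t_def)
    have "t \<in> r ` N" unfolding t_def using fN \<open>N \<noteq> {}\<close> by (intro Min_in) auto
    then obtain g where g: "g \<in> N" "t = r g" by blast
    have lez: "le_sign H (z t) w" using le t1 tr by simp
    have gH: "g \<in> H" and gw: "g w \<noteq> 0" "g x \<noteq> 0" 
      using g(1) sg[of g] by (auto simp: N_def sgn_if split: if_splits)
    have gz: "g (z t) = 0"
    proof -
      have "t * (\<bar>g w\<bar> - \<bar>g x\<bar>) = \<bar>g w\<bar>" using g by (simp add: r_def N_def)
      then have "(1 - t) * \<bar>g w\<bar> + t * \<bar>g x\<bar> = 0" by (simp add: algebra_simps)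
      moreover have "g w = sgn (g w) * \<bar>g w\<bar>" "g x = sgn (g w) * \<bar>g x\<bar>"
        using sg[OF gH] by (simp_all add: sgn_mult_abs) (metis mult_sgn_abs)
      ultimately show ?thesis unfolding hz[OF gH]
        by (metis distrib_left mult.left_commute mult_zero_right)
    qed
    have zP: "z t \<in> P" using downward[OF _ zR lez] w(1) W_subset by blast
    have lezx: "le_sign H (z t) x" using lez w(2) same_sign_le same_sign_sym le_sign_trans by blast
    have "{h \<in> H. h (z t) \<noteq> 0} \<subset> {h \<in> H. h x \<noteq> 0}"
      using lezx gz gH gw unfolding le_sign_def by (auto simp: sgn_0_0 psubset_eq)
    then have "card {h \<in> H. h (z t) \<noteq> 0} < card {h \<in> H. h x \<noteq> 0}"
      using finite_H by (intro psubset_card_mono) auto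
    then obtain C where C: "chain C" "\<forall>v\<in>C. le_sign H v (z t)" "z t \<in> convex hull C"
      using less.hyps zP by blast
    have le_w: "\<forall>v\<in>C. le_sign H v w" using C(2) lez le_sign_trans by blast
    have ch: "chain (insert w C)" using C(1) w(1) le_w by (auto simp: chain_def le_sign_refl)
    have "x = (1 - 1/t) *\<^sub>R w + (1/t) *\<^sub>R z t"
    proof -
      have "(1/t) *\<^sub>R z t = (1/t - 1) *\<^sub>R w + x"
        using t1 by (simp add: z_def scaleR_add_right diff_divide_distrib)
      then show ?thesis by (simp add: algebra_simps)
    qed
    moreover have "w \<in> convex hull (insert w C)" "z t \<in> convex hull (insert w C)"
      using C(3) hull_mono[of C "insert w C" convex] by (auto simp: hull_inc)
    moreover have "0 \<le> 1 - 1/t" "0 \<le> 1/t" using t1 by (auto simp: field_simps)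
    ultimately have "x \<in> convex hull (insert w C)"
      using convexD[OF convex_convex_hull, of w "insert w C" "z t" "1 - 1/t" "1/t"] by simp
    moreover have "\<forall>v\<in>insert w C. le_sign H v x"
      using le_w w(2) same_sign_le same_sign_sym le_sign_trans by blast
    ultimately show ?thesis using ch by blast
  qed
qed

definition chain_complex :: "point set set" where
  "chain_complex = (\<lambda>C. convex hull C) ` {C. chain C}"

lemma chain_hull_subset:
  assumes "chain C"
  shows "convex hull C \<subseteq> P"
proof (cases "C = {}")
  case False
  then obtain c where c: "c \<in> C" "\<And>v. v \<in> C \<Longrightarrow> le_sign H v c" using chain_top assms by metis
  have "C \<subseteq> Rspace n" "c \<in> P" using assms W_subset P_subset c(1) unfolding chain_def by auto
  then have "convex hull C \<subseteq> Rspace n" by (intro hull_minimal convex_Rspace)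
  then show ?thesis using downward[OF \<open>c \<in> P\<close>] hull_le_top[OF c(2)] by blast
qed simp

lemma chain_complex_triangulation: "rational_triangulation n P chain_complex"
  unfolding rational_triangulation_def
proof (intro conjI allI impI ballI)
  show "finite chain_complex" unfolding chain_complex_def
    using finite_W by (intro finite_imageI finite_subset[of "Collect chain" "Pow W"]) (auto simp: chain_def)
  show "rational_simplex n T" if T: "T \<in> chain_complex" for T
  proof -
    obtain C where C: "chain C" "T = convex hull C" using T unfolding chain_complex_def by blast
    then have "C \<subseteq> W" by (simp add: chain_def)
    then show ?thesis unfolding rational_simplex_def
      using C finite_chain chain_affine_independent W_subset P_subset rational
      by (intro exI[of _ C]) blast
  qed
  show "F \<in> chain_complex" if T: "T \<in> chain_complex \<and> F face_of T" for F T
  proof -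
    obtain C where C: "chain C" "T = convex hull C" using T unfolding chain_complex_def by blast
    then have "F = convex hull (C \<inter> F)" using T face_of_convex_hull_finite finite_chain by metis
    then show ?thesis unfolding chain_complex_def using C chain_subset[of C "C \<inter> F"] by blast
  qed
  show "T \<inter> T' face_of T" if TT: "T \<in> chain_complex \<and> T' \<in> chain_complex" for T T'
  proof -
    obtain C D where C: "chain C" "T = convex hull C" and D: "chain D" "T' = convex hull D"
      using TT unfolding chain_complex_def by blast
    have "T \<inter> T' = convex hull (C \<inter> D)"
      using hull_inter_subset[OF C(1) D(1)] C D hull_mono[of "C \<inter> D" C convex] hull_mono[of "C \<inter> D" D convex] by blast
    then show ?thesis using face_of_simplex_subset[of C "C \<inter> D"] C finite_chain chain_affine_independent by auto
  qed
  show "\<Union> chain_complex = P"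
    using point_in_chain_hull chain_hull_subset unfolding chain_complex_def by blast
qed

lemma chain_complex_top:
  assumes "T \<in> chain_complex" "T \<noteq> {}"
  shows "\<exists>c\<in>P. \<forall>x\<in>T. x \<in> Rspace n \<and> le_sign H x c"
proof -
  obtain C where C: "chain C" "T = convex hull C" using assms unfolding chain_complex_def by blast
  then have "C \<noteq> {}" using assms by auto
  then obtain c where c: "c \<in> C" "\<And>v. v \<in> C \<Longrightarrow> le_sign H v c" using chain_top C(1) by metis
  have "c \<in> P" using c C W_subset by (auto simp: chain_def)
  then show ?thesis using hull_le_top[OF c(2)] chain_hull_subset[OF C(1)] C(2) P_subset by blast
qed

end

section \<open>Rational polytopes and refining triangulations\<close>

text \<open>
  Bounded intersections of finitely many rational half-spaces. Unlike simplexes, these are closed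
  under intersection, also with preimages under rational affine maps.
\<close>

definition rational_polytope :: "nat \<Rightarrow> point set \<Rightarrow> bool" where
  "rational_polytope n T \<longleftrightarrow>
     (\<exists>H. finite H \<and> (\<forall>h\<in>H. rational_form n h) \<and> T = {x \<in> Rspace n. \<forall>h\<in>H. 0 \<le> h x} \<and>
          (\<exists>B. \<forall>x\<in>T. \<forall>i<n. \<bar>Poly_Mapping.lookup x i\<bar> \<le> B))"

lemma rational_polytope_subset: "rational_polytope n T \<Longrightarrow> T \<subseteq> Rspace n"
  unfolding rational_polytope_def by blast

lemma rational_polytope_bounded:
  assumes "rational_polytope n T"
  shows "\<exists>B. \<forall>x\<in>T. \<forall>i<n. \<bar>Poly_Mapping.lookup x i\<bar> \<le> B"
  using assms unfolding rational_polytope_def by blast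

lemma convex_form_nonneg:
  assumes "affine_form K n h"
  shows "convex {x. 0 \<le> h x}"
  unfolding convex_def using affine_form_segment[OF assms] by simp

text \<open>
  The arrangement consists of \<open>G\<close> and of all forms that occur in the descriptions of the polytopes in
  \<open>F\<close>. Each polytope is then a union of closed cells, and a simplex of the subdivision lies in the
  closed cell of its top vertex, on which no form of the arrangement changes its sign.
\<close>

theorem triangulation_refining:
  assumes fin: "finite F" "finite G" and F: "\<And>T. T \<in> F \<Longrightarrow> rational_polytope n T"
    and G: "\<And>g. g \<in> G \<Longrightarrow> rational_form n g"
  shows "\<exists>\<Delta>. rational_triangulation n (\<Union>F) \<Delta> \<and>
    (\<forall>T\<in>\<Delta>. T \<noteq> {} \<longrightarrow> (\<exists>U\<in>F. T \<subseteq> U)) \<and>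
    (\<forall>T\<in>\<Delta>. \<forall>g\<in>G. (\<forall>x\<in>T. 0 \<le> g x) \<or> (\<forall>x\<in>T. g x \<le> 0))"
proof -
  define P where "P = \<Union>F"
  have "\<forall>T\<in>F. \<exists>H. finite H \<and> (\<forall>h\<in>H. rational_form n h) \<and> T = {x \<in> Rspace n. \<forall>h\<in>H. 0 \<le> h x}"
  proof
    fix T assume "T \<in> F"
    from F[OF this] show "\<exists>H. finite H \<and> (\<forall>h\<in>H. rational_form n h) \<and> T = {x \<in> Rspace n. \<forall>h\<in>H. 0 \<le> h x}"
      unfolding rational_polytope_def by (elim exE conjE) (intro exI conjI)
  qed
  from bchoice[OF this] obtain Hs where Hs': "\<forall>T\<in>F. finite (Hs T) \<and> (\<forall>h\<in>Hs T. rational_form n h) \<and>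
      T = {x \<in> Rspace n. \<forall>h\<in>Hs T. 0 \<le> h x}" ..
  have Hs: "finite (Hs T)" "\<And>h. h \<in> Hs T \<Longrightarrow> rational_form n h" if "T \<in> F" for T
    using bspec[OF Hs' that] by auto
  have mem: "x \<in> T \<longleftrightarrow> x \<in> Rspace n \<and> (\<forall>h\<in>Hs T. 0 \<le> h x)" if "T \<in> F" for T x
  proof -
    have "T = {x \<in> Rspace n. \<forall>h\<in>Hs T. 0 \<le> h x}" using bspec[OF Hs' that] by blast
    then have "x \<in> T \<longleftrightarrow> x \<in> {x \<in> Rspace n. \<forall>h\<in>Hs T. 0 \<le> h x}" by (rule arg_cong)
    then show ?thesis by simp
  qed
  define H where "H = G \<union> (\<Union>T\<in>F. Hs T)"
  have finH: "finite H" unfolding H_def using fin Hs by blast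
  have formH: "rational_form n h" if "h \<in> H" for h using that G Hs(2) unfolding H_def by blast
  have PR: "P \<subseteq> Rspace n" unfolding P_def using F rational_polytope_subset by blast
  have closed: "x \<in> U" if "U \<in> F" "y \<in> U" "x \<in> Rspace n" "le_sign H x y" for x y U
  proof -
    have "0 \<le> h x" if "h \<in> Hs U" for h
    proof -
      have "h \<in> H" using that \<open>U \<in> F\<close> unfolding H_def by blast
      then have "h x = 0 \<or> sgn (h x) = sgn (h y)" using \<open>le_sign H x y\<close> unfolding le_sign_def by blast
      moreover have "0 \<le> h y" using mem[OF \<open>U \<in> F\<close>] \<open>y \<in> U\<close> that by blast
      ultimately show ?thesis by (auto simp: sgn_if split: if_splits)
    qed
    then show ?thesis using mem[OF \<open>U \<in> F\<close>] that(3) by blast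
  qed
  \<comment> \<open>the vector of signs of x, of which only finitely many occur\<close>
  define sv where "sv x = restrict (\<lambda>h. sgn (h x)) H" for x :: point
  have sv: "sv x = sv y \<longleftrightarrow> same_sign H x y" for x y
    unfolding sv_def same_sign_def restrict_def fun_eq_iff by (simp only: Ball_def) presburger
  have "sgn t \<in> {-1, 0, 1}" for t :: real by (simp add: sgn_if)
  then have "sv ` P \<subseteq> PiE H (\<lambda>_. {-1, 0, 1})" unfolding sv_def by (intro image_subsetI) auto
  then have finsv: "finite (sv ` P)" using finite_PiE[OF finH, of "\<lambda>_. {-1, 0, 1}"] finite_subset by auto
  have "\<exists>q. q \<in> Rspace n \<and> (\<forall>i<n. Poly_Mapping.lookup q i \<in> \<rat>) \<and> same_sign H q x" for x
    using rational_point_same_signs[OF finH formH, where x = x] unfolding same_sign_def by metis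
  then obtain q where q: "\<And>x. q x \<in> Rspace n" "\<And>x i. i < n \<Longrightarrow> Poly_Mapping.lookup (q x) i \<in> \<rat>"
    "\<And>x. same_sign H (q x) x" by metis
  have qP: "q x \<in> P" if "x \<in> P" for x
    using closed[OF _ _ q(1) same_sign_le[OF q(3)]] that unfolding P_def by blast
  define r where "r s = q (inv_into P sv s)" for s
  define W where "W = r ` sv ` P"
  have svW: "sv (r s) = s" if "s \<in> sv ` P" for s
    using q(3)[of "inv_into P sv s"] f_inv_into_f[OF that] sv unfolding r_def by metis
  interpret sign_cells n H P W
  proof
    show "finite H" "\<And>h. h \<in> H \<Longrightarrow> rational_form n h" "P \<subseteq> Rspace n" using finH formH PR by auto
    show "finite W" unfolding W_def using finsv by blast
    show "W \<subseteq> P" unfolding W_def r_def using qP inv_into_into by (metis image_subsetI)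
    show "w = w'" if w: "w \<in> W" "w' \<in> W" "same_sign H w w'" for w w'
    proof -
      obtain s s' where s: "s \<in> sv ` P" "w = r s" "s' \<in> sv ` P" "w' = r s'"
        using w(1,2) unfolding W_def by blast
      have "sv (r s) = sv (r s')" using sv[of w w'] w(3) unfolding s(2,4) by blast
      then have "s = s'" unfolding svW[OF s(1)] svW[OF s(3)] .
      then show ?thesis using s by simp
    qed
    show "\<exists>w\<in>W. same_sign H x w" if "x \<in> P" for x
    proof -
      have "sv x \<in> sv ` P" using that by blast
      then have "r (sv x) \<in> W" "sv x = sv (r (sv x))" using svW[of "sv x"] unfolding W_def by auto
      then have "r (sv x) \<in> W" "same_sign H x (r (sv x))" using sv by blast+
      then show ?thesis by blast
    qed
    show "x \<in> P" if "y \<in> P" "x \<in> Rspace n" "le_sign H x y" for x y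
      using closed that unfolding P_def by blast
    show "Poly_Mapping.lookup w i \<in> \<rat>" if "w \<in> W" "i < n" for w i
      using that q(2) unfolding W_def r_def by blast
    have "\<exists>B. \<forall>x\<in>\<Union>F'. \<forall>i<n. \<bar>Poly_Mapping.lookup x i\<bar> \<le> B" if "finite F'" "F' \<subseteq> F" for F'
      using that
    proof (induction rule: finite_induct)
      case (insert T F')
      obtain B B' where "\<forall>x\<in>T. \<forall>i<n. \<bar>Poly_Mapping.lookup x i\<bar> \<le> B" 
        "\<forall>x\<in>\<Union>F'. \<forall>i<n. \<bar>Poly_Mapping.lookup x i\<bar> \<le> B'"
        using insert F rational_polytope_bounded by (metis insert_subset)
      then have "\<forall>x\<in>\<Union>(insert T F'). \<forall>i<n. \<bar>Poly_Mapping.lookup x i\<bar> \<le> max B B'"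
        by (auto simp: le_max_iff_disj)
      then show ?case by blast
    qed simp
    then show "\<exists>B. \<forall>x\<in>P. \<forall>i<n. \<bar>Poly_Mapping.lookup x i\<bar> \<le> B" unfolding P_def using fin by blast
  qed
  show ?thesis
  proof (intro exI conjI ballI impI)
    show "rational_triangulation n (\<Union>F) chain_complex" using chain_complex_triangulation by (simp add: P_def)
    show "\<exists>U\<in>F. T \<subseteq> U" if "T \<in> chain_complex" "T \<noteq> {}" for T
      using chain_complex_top[OF that] closed unfolding P_def by blast
    show "(\<forall>x\<in>T. 0 \<le> g x) \<or> (\<forall>x\<in>T. g x \<le> 0)" if T: "T \<in> chain_complex" and "g \<in> G" for T g
    proof (cases "T = {}")
      case False
      obtain c where c: "\<And>x. x \<in> T \<Longrightarrow> le_sign H x c"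
        using chain_complex_top[OF T False] by metis
      have gH: "g \<in> H" using \<open>g \<in> G\<close> by (simp add: H_def)
      have "g x = 0 \<or> sgn (g x) = sgn (g c)" if "x \<in> T" for x
        using c[OF that] gH unfolding le_sign_def by blast
      then have "g x = 0 \<or> (0 < g x) = (0 < g c)" if "x \<in> T" for x
        using that by (metis sgn_greater)
      then show ?thesis by (metis less_eq_real_def linorder_not_less)
    qed simp
  qed
qed

lemma rational_form_value:
  assumes "rational_form n h" "\<forall>i<n. Poly_Mapping.lookup v i \<in> \<rat>"
  shows "h v \<in> \<rat>"
  using assms unfolding affine_form_def by (auto intro!: Rats_add Rats_sum Rats_mult)

lemma sum_kronecker:
  fixes \<beta> :: "'a \<Rightarrow> 'a \<Rightarrow> real"
  assumes "finite V" "v \<in> V" "\<And>w. w \<in> V \<Longrightarrow> \<beta> w v = (if w = v then 1 else 0)"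
  shows "(\<Sum>w\<in>V. a w * \<beta> w v) = a v"
proof -
  have "(\<Sum>w\<in>V. a w * \<beta> w v) = (\<Sum>w\<in>V. if w = v then a w else 0)"
    using assms(3) by (intro sum.cong) auto
  then show ?thesis using assms(1,2) by simp
qed

text \<open>
  Barycentric coordinates as rational forms on the whole ambient space. For a new vertex \<open>c\<close>, one of
  the residual forms \<open>1 - \<Sum> \<beta>\<^sub>w\<close> and \<open>x\<^sub>i - \<Sum> w\<^sub>i \<beta>\<^sub>w\<close>, which vanish on the old vertices, is nonzero at \<open>c\<close>:
  otherwise \<open>c\<close> would be an affine combination of the old vertices. Dividing it by its value at \<open>c\<close> gives
  the coordinate of \<open>c\<close>, with which the old coordinates are corrected.
\<close>

lemma barycentric_forms:
  assumes "finite V" "V \<subseteq> Rspace n" "\<forall>v\<in>V. \<forall>i<n. Poly_Mapping.lookup v i \<in> \<rat>" "\<not> affine_dependent V"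
  shows "\<exists>\<beta>. (\<forall>v\<in>V. rational_form n (\<beta> v)) \<and> (\<forall>v\<in>V. \<forall>w\<in>V. \<beta> v w = (if v = w then 1 else 0))"
  using assms
proof (induction rule: finite_induct)
  case (insert c V)
  have "\<not> affine_dependent V" using insert.prems affine_dependent_subset by blast
  then have "\<exists>\<beta>. (\<forall>v\<in>V. rational_form n (\<beta> v)) \<and> (\<forall>v\<in>V. \<forall>w\<in>V. \<beta> v w = (if v = w then 1 else 0))"
    using insert.IH insert.prems by auto
  then obtain \<beta> where \<beta>: "\<And>v. v \<in> V \<Longrightarrow> rational_form n (\<beta> v)"
    "\<And>v w. v \<in> V \<Longrightarrow> w \<in> V \<Longrightarrow> \<beta> v w = (if v = w then 1 else 0)"
    by metis
  have "\<exists>\<epsilon>. rational_form n \<epsilon> \<and> (\<forall>v\<in>V. \<epsilon> v = 0) \<and> \<epsilon> c \<noteq> 0"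
  proof (rule ccontr)
    assume no: "\<not> ?thesis"
    have "rational_form n (\<lambda>x. 1 - (\<Sum>w\<in>V. \<beta> w x))"
      by (intro rational_form_diff rational_form_sum rational_form_const \<beta>) auto
    moreover have "\<forall>v\<in>V. 1 - (\<Sum>w\<in>V. \<beta> w v) = 0" using insert.hyps \<beta>(2) by simp
    ultimately have 1: "(\<Sum>w\<in>V. \<beta> w c) = 1" using no by force
    have "Poly_Mapping.lookup c i = (\<Sum>w\<in>V. \<beta> w c * Poly_Mapping.lookup w i)" if "i < n" for i
    proof -
      have "rational_form n (\<lambda>x. Poly_Mapping.lookup x i - (\<Sum>w\<in>V. Poly_Mapping.lookup w i * \<beta> w x))"
        using insert.prems(2) that
        by (intro rational_form_diff rational_form_sum rational_form_scale rational_form_coord \<beta>) auto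
      moreover have "\<forall>v\<in>V. Poly_Mapping.lookup v i - (\<Sum>w\<in>V. Poly_Mapping.lookup w i * \<beta> w v) = 0" 
        using sum_kronecker[OF insert.hyps(1), where \<beta> = \<beta>] \<beta>(2) by simp
      ultimately show ?thesis using no by (force simp: mult.commute)
    qed
    moreover have "(\<Sum>w\<in>V. \<beta> w c *\<^sub>R w) \<in> Rspace n"
      using insert.prems(1) by (auto simp: Rspace_iff lookup_linear_sum intro!: sum.neutral)
    ultimately have "c = (\<Sum>w\<in>V. \<beta> w c *\<^sub>R w)"
      using insert.prems(1) by (intro Rspace_eqI) (auto simp: lookup_linear_sum)
    then have "c \<in> affine hull V" unfolding affine_hull_finite[OF insert.hyps(1)] 
      using 1 by (auto intro!: exI[of _ "\<lambda>w. \<beta> w c"])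
    then show False using insert.prems(3) insert.hyps(2) unfolding affine_dependent_def by auto
  qed
  then obtain \<epsilon> where \<epsilon>: "rational_form n \<epsilon>" "\<And>v. v \<in> V \<Longrightarrow> \<epsilon> v = 0" "\<epsilon> c \<noteq> 0" by blast
  define \<epsilon>' where "\<epsilon>' x = (1 / \<epsilon> c) * \<epsilon> x" for x
  have \<epsilon>': "rational_form n \<epsilon>'" "\<And>v. v \<in> V \<Longrightarrow> \<epsilon>' v = 0" "\<epsilon>' c = 1"
  proof -
    have "\<epsilon> c \<in> \<rat>" using rational_form_value[OF \<epsilon>(1)] insert.prems(2) by blast
    then show "rational_form n \<epsilon>'" unfolding \<epsilon>'_def by (intro rational_form_scale \<epsilon>) auto
  qed (use \<epsilon> in \<open>auto simp: \<epsilon>'_def\<close>)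
  define \<beta>' where "\<beta>' v = (if v = c then \<epsilon>' else (\<lambda>x. \<beta> v x - \<beta> v c * \<epsilon>' x))" for v
  have "rational_form n (\<beta>' v)" if "v \<in> insert c V" for v
    using that \<epsilon>' \<beta>(1) rational_form_value[OF \<beta>(1)] insert.prems(2)
    by (auto simp: \<beta>'_def intro!: rational_form_diff rational_form_scale)
  moreover have "\<beta>' v w = (if v = w then 1 else 0)" if "v \<in> insert c V" "w \<in> insert c V" for v w
    using that \<epsilon>' \<beta>(2) insert.hyps(2) by (auto simp: \<beta>'_def)
  ultimately show ?case by blast
qed simp

text \<open>
  The inequalities say that the barycentric coordinates are nonnegative; the equations, written as pairs
  of inequalities, say that the point is reproduced by its barycentric coordinates.
\<close>

lemma rational_simplex_polytope:
  assumes "rational_simplex n T"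
  shows "rational_polytope n T"
proof -
  obtain V where V: "finite V" "V \<subseteq> Rspace n" "\<forall>v\<in>V. \<forall>i<n. Poly_Mapping.lookup v i \<in> \<rat>"
    "\<not> affine_dependent V" and T: "T = convex hull V"
    using assms unfolding rational_simplex_def by blast
  obtain \<beta> where \<beta>: "\<And>v. v \<in> V \<Longrightarrow> rational_form n (\<beta> v)"
    "\<And>v w. v \<in> V \<Longrightarrow> w \<in> V \<Longrightarrow> \<beta> v w = (if v = w then 1 else 0)"
    using barycentric_forms[OF V] by blast
  define e where "e x = 1 - (\<Sum>v\<in>V. \<beta> v x)" for x
  define c where "c i x = Poly_Mapping.lookup x i - (\<Sum>v\<in>V. Poly_Mapping.lookup v i * \<beta> v x)" for i x
  define E where "E = insert e (c ` {..<n})"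
  define H where "H = \<beta> ` V \<union> E \<union> (\<lambda>h x. (-1) * h x) ` E"
  have e: "rational_form n e"
    unfolding e_def by (intro rational_form_diff rational_form_sum rational_form_const \<beta>) auto
  have "rational_form n (c i)" if "i < n" for i
    unfolding c_def using V(3) that
    by (intro rational_form_diff rational_form_sum rational_form_scale rational_form_coord \<beta>) auto
  then have E: "rational_form n h" if "h \<in> E" for h using e that unfolding E_def by blast
  have H: "rational_form n h" if "h \<in> H" for h
    using that E \<beta>(1) rational_form_scale[of "-1"] unfolding H_def by auto
  have "finite H" unfolding H_def E_def using V(1) by simp
  have EV: "h v = 0" if "h \<in> E" "v \<in> V" for h v
  proof -
    have "(\<Sum>w\<in>V. a w * \<beta> w v) = a v" for a :: "point \<Rightarrow> real"
      using sum_kronecker[OF V(1) that(2)] \<beta>(2) that(2) by blast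
    from this[of "\<lambda>_. 1"] this show ?thesis using that(1) by (auto simp: E_def e_def c_def)
  qed
  define U where "U = {x \<in> Rspace n. \<forall>h\<in>H. 0 \<le> h x}"
  have "T = U"
  proof
    have "U = Rspace n \<inter> (\<Inter>h\<in>H. {x. 0 \<le> h x})" unfolding U_def by blast
    moreover have "convex (\<Inter>h\<in>H. {x. 0 \<le> h x})" 
      using convex_form_nonneg H by (intro convex_INT) blast
    ultimately have "convex U" using convex_Rspace convex_Int by metis
    moreover have "0 \<le> h v" if v: "v \<in> V" and h: "h \<in> H" for v h
    proof -
      from h consider w where "w \<in> V" "h = \<beta> w" | "h \<in> E" | k where "k \<in> E" "h = (\<lambda>x. (-1) * k x)"
        unfolding H_def by blast
      then show ?thesis
      proof cases
        case 1
        then show ?thesis using \<beta>(2) v by simp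
      next
        case 2
        then show ?thesis using EV[OF 2 v] by simp
      next
        case 3
        then show ?thesis using EV[OF 3(1) v] by simp
      qed
    qed
    then have "V \<subseteq> U" unfolding U_def using V(2) by blast
    ultimately show "T \<subseteq> U" unfolding T by (intro hull_minimal)
    show "U \<subseteq> T"
    proof
      fix x assume x: "x \<in> U"
      have pos: "0 \<le> h x" if "h \<in> H" for h using x that unfolding U_def by blast
      have zero: "h x = 0" if "h \<in> E" for h
      proof -
        have "h \<in> H" "(\<lambda>x. (-1) * h x) \<in> H" using that unfolding H_def by auto
        from pos[OF this(1)] pos[OF this(2)] show ?thesis by simp
      qed
      have "(\<Sum>v\<in>V. \<beta> v x) = 1" using zero[of e] by (simp add: E_def e_def)
      moreover have "0 \<le> \<beta> v x" if "v \<in> V" for v using pos[of "\<beta> v"] that by (simp add: H_def)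
      ultimately have "(\<Sum>v\<in>V. \<beta> v x *\<^sub>R v) \<in> T" unfolding T 
        using V(1) by (intro convex_sum) (auto simp: hull_inc)
      moreover have "(\<Sum>v\<in>V. \<beta> v x *\<^sub>R v) = x"
      proof (rule Rspace_eqI)
        show "(\<Sum>v\<in>V. \<beta> v x *\<^sub>R v) \<in> Rspace n"
          using V(2) by (auto simp: Rspace_iff lookup_linear_sum intro!: sum.neutral)
        show "x \<in> Rspace n" using x unfolding U_def by blast
        show "Poly_Mapping.lookup (\<Sum>v\<in>V. \<beta> v x *\<^sub>R v) i = Poly_Mapping.lookup x i" if "i < n" for i
          using zero[of "c i"] that by (simp add: E_def c_def lookup_linear_sum mult.commute)
      qed
      ultimately show "x \<in> T" by simp
    qed
  qed
  moreover have "\<bar>Poly_Mapping.lookup x i\<bar> \<le> (\<Sum>j<n. \<Sum>v\<in>V. \<bar>Poly_Mapping.lookup v j\<bar>)" if "x \<in> T" "i < n" for x i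
  proof -
    obtain u where u: "\<forall>v\<in>V. 0 \<le> u v" "sum u V = 1" "(\<Sum>v\<in>V. u v *\<^sub>R v) = x"
      using \<open>x \<in> T\<close> unfolding T convex_hull_finite[OF V(1)] by auto
    have "\<bar>Poly_Mapping.lookup x i\<bar> \<le> (\<Sum>v\<in>V. \<bar>u v * Poly_Mapping.lookup v i\<bar>)"
      unfolding u(3)[symmetric] lookup_linear_sum by (rule sum_abs)
    also have "\<dots> \<le> (\<Sum>v\<in>V. \<bar>Poly_Mapping.lookup v i\<bar>)"
    proof (intro sum_mono)
      fix v assume "v \<in> V"
      then have "u v \<le> 1" "0 \<le> u v" using u(1,2) V(1) member_le_sum[of v V u] by auto
      then show "\<bar>u v * Poly_Mapping.lookup v i\<bar> \<le> \<bar>Poly_Mapping.lookup v i\<bar>"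
        by (simp add: abs_mult mult_left_le_one_le)
    qed
    also have "\<dots> \<le> (\<Sum>j<n. \<Sum>v\<in>V. \<bar>Poly_Mapping.lookup v j\<bar>)"
      using \<open>i < n\<close> member_le_sum[of i "{..<n}" "\<lambda>j. \<Sum>v\<in>V. \<bar>Poly_Mapping.lookup v j\<bar>"] by (simp add: sum_nonneg)
    finally show ?thesis .
  qed
  ultimately have bounded: "\<exists>B. \<forall>x\<in>T. \<forall>i<n. \<bar>Poly_Mapping.lookup x i\<bar> \<le> B" and eq: "T = U" by blast+
  have "T = {x \<in> Rspace n. \<forall>h\<in>H. 0 \<le> h x}" using eq unfolding U_def .
  then show ?thesis
    unfolding rational_polytope_def using \<open>finite H\<close> H bounded by (intro exI[of _ H] conjI ballI)
qed

lemma rational_polytopeI: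
  assumes "finite H" "\<And>h. h \<in> H \<Longrightarrow> rational_form n h" "T = {x \<in> Rspace n. \<forall>h\<in>H. 0 \<le> h x}"
    "\<And>x i. x \<in> T \<Longrightarrow> i < n \<Longrightarrow> \<bar>Poly_Mapping.lookup x i\<bar> \<le> B"
  shows "rational_polytope n T"
  unfolding rational_polytope_def
  using assms(1,2,4) by (intro exI[of _ H] conjI ballI assms(3) exI[of _ B] allI impI)

lemma rational_polytopeE:
  assumes "rational_polytope n T"
  obtains H B where "finite H" "\<And>h. h \<in> H \<Longrightarrow> rational_form n h" "\<And>x. x \<in> T \<longleftrightarrow> x \<in> Rspace n \<and> (\<forall>h\<in>H. 0 \<le> h x)"
    "\<And>x i. x \<in> T \<Longrightarrow> i < n \<Longrightarrow> \<bar>Poly_Mapping.lookup x i\<bar> \<le> B"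
  using assms unfolding rational_polytope_def
proof (elim exE conjE)
  fix H B
  assume H: "finite H" "\<forall>h\<in>H. rational_form n h" and T: "T = {x \<in> Rspace n. \<forall>h\<in>H. 0 \<le> h x}"
    and B: "\<forall>x\<in>T. \<forall>i<n. \<bar>Poly_Mapping.lookup x i\<bar> \<le> B"
  show thesis
  proof (rule that)
    show "x \<in> T \<longleftrightarrow> x \<in> Rspace n \<and> (\<forall>h\<in>H. 0 \<le> h x)" for x by (subst T) simp
  qed (use H B in auto)
qed

lemma form_bounded_on_polytope:
  assumes "affine_form K n h" "rational_polytope n T"
  obtains B where "\<And>x. x \<in> T \<Longrightarrow> \<bar>h x\<bar> \<le> B"
proof -
  obtain a b where h: "h = (\<lambda>x. (\<Sum>i<n. a i * Poly_Mapping.lookup x i) + b)"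
    using assms(1) unfolding affine_form_def by blast
  obtain B where B: "\<And>x i. x \<in> T \<Longrightarrow> i < n \<Longrightarrow> \<bar>Poly_Mapping.lookup x i\<bar> \<le> B"
    by (rule rational_polytopeE[OF assms(2)]) (rule that, blast)
  have "\<bar>h x\<bar> \<le> (\<Sum>i<n. \<bar>a i\<bar> * B) + \<bar>b\<bar>" if x: "x \<in> T" for x
  proof -
    have "\<bar>\<Sum>i<n. a i * Poly_Mapping.lookup x i\<bar> \<le> (\<Sum>i<n. \<bar>a i\<bar> * B)"
      using B[OF x] by (intro order_trans[OF sum_abs] sum_mono) (auto simp: abs_mult intro!: mult_left_mono)
    then show ?thesis unfolding h by linarith
  qed
  then show ?thesis using that by blast
qed

lemma rational_polytope_preimage:
  assumes T: "rational_polytope n T" and U: "rational_polytope m U"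
    and g: "\<And>i. i < m \<Longrightarrow> rational_form n (g i)"
  shows "rational_polytope n {x \<in> T. point_of m (\<lambda>i. g i x) \<in> U}"
proof -
  obtain H B where H: "finite H" "\<And>h. h \<in> H \<Longrightarrow> rational_form n h"
    "\<And>x. x \<in> T \<longleftrightarrow> x \<in> Rspace n \<and> (\<forall>h\<in>H. 0 \<le> h x)"
    "\<And>x i. x \<in> T \<Longrightarrow> i < n \<Longrightarrow> \<bar>Poly_Mapping.lookup x i\<bar> \<le> B"
    using T by (rule rational_polytopeE) blast
  obtain H' where H': "finite H'" "\<And>h. h \<in> H' \<Longrightarrow> rational_form m h"
    "\<And>x. x \<in> U \<longleftrightarrow> x \<in> Rspace m \<and> (\<forall>h\<in>H'. 0 \<le> h x)"
    using U by (rule rational_polytopeE) blast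
  show ?thesis
  proof (rule rational_polytopeI[of "H \<union> (\<lambda>h x. h (point_of m (\<lambda>i. g i x))) ` H'"])
    show "rational_form n h" if "h \<in> H \<union> (\<lambda>h x. h (point_of m (\<lambda>i. g i x))) ` H'" for h
      using that H(2) H'(2) g by (auto intro: rational_form_compose)
  qed (use H(1,3,4) H'(1,3) in auto)
qed

text \<open>
  With an affine left inverse no variables need to be eliminated: \<open>y\<close> is in the image iff its
  candidate preimage lies in \<open>T\<close> and is mapped back to \<open>y\<close>.
\<close>

lemma rational_polytope_image:
  assumes T: "rational_polytope n T" and g: "\<And>i. i < m \<Longrightarrow> rational_form n (g i)"
    and p: "\<And>j. j < n \<Longrightarrow> rational_form m (p j)"
    and inv: "\<And>x. x \<in> T \<Longrightarrow> point_of n (\<lambda>j. p j (point_of m (\<lambda>i. g i x))) = x"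
  shows "rational_polytope m ((\<lambda>x. point_of m (\<lambda>i. g i x)) ` T)"
proof -
  define G where "G x = point_of m (\<lambda>i. g i x)" for x
  define pull where "pull y = point_of n (\<lambda>j. p j y)" for y
  obtain H where H: "finite H" "\<And>h. h \<in> H \<Longrightarrow> rational_form n h"
    "\<And>x. x \<in> T \<longleftrightarrow> x \<in> Rspace n \<and> (\<forall>h\<in>H. 0 \<le> h x)"
    using T by (rule rational_polytopeE) blast
  have "\<forall>i\<in>{..<m}. \<exists>B. \<forall>x\<in>T. \<bar>g i x\<bar> \<le> B"
    using form_bounded_on_polytope[OF g T] by (metis lessThan_iff)
  from bchoice[OF this] obtain B where B: "\<forall>i\<in>{..<m}. \<forall>x\<in>T. \<bar>g i x\<bar> \<le> B i" ..
  define d where "d i y = g i (pull y) - Poly_Mapping.lookup y i" for i y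
  have d: "rational_form m (d i)" if "i < m" for i
    unfolding d_def pull_def using that g p by (intro rational_form_diff rational_form_compose rational_form_coord) auto
  define H' where "H' = (\<lambda>h y. h (pull y)) ` H \<union> d ` {..<m} \<union> (\<lambda>i y. - d i y) ` {..<m}"
  have "rational_polytope m (G ` T)"
  proof (rule rational_polytopeI[of H'])
    show "finite H'" unfolding H'_def using H(1) by simp
    show "rational_form m h" if "h \<in> H'" for h
      using that H(2) d p unfolding H'_def pull_def
      by (auto intro!: rational_form_compose rational_form_uminus)
    show "G ` T = {y \<in> Rspace m. \<forall>h\<in>H'. 0 \<le> h y}"
    proof (intro equalityI subsetI)
      fix y assume "y \<in> G ` T"
      then obtain x where x: "x \<in> T" "y = G x" by blast
      have "pull y = x" using inv[OF x(1)] by (simp add: x pull_def G_def)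
      moreover have "d i y = 0" if "i < m" for i using that calculation by (simp add: d_def x G_def)
      ultimately have "0 \<le> h y" if "h \<in> H'" for h using that x(1) H(3) by (auto simp: H'_def)
      then show "y \<in> {y \<in> Rspace m. \<forall>h\<in>H'. 0 \<le> h y}" using x by (simp add: G_def)
    next
      fix y assume y: "y \<in> {y \<in> Rspace m. \<forall>h\<in>H'. 0 \<le> h y}"
      have "h (pull y) \<ge> 0" if "h \<in> H" for h using y that by (auto simp: H'_def)
      then have 1: "pull y \<in> T" using H(3) by (simp add: pull_def)
      have "g i (pull y) = Poly_Mapping.lookup y i" if "i < m" for i
      proof -
        have "d i \<in> H'" "(\<lambda>y. - d i y) \<in> H'" using that by (auto simp: H'_def)
        moreover have "\<forall>h\<in>H'. 0 \<le> h y" using y by blast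
        ultimately have "0 \<le> d i y" "0 \<le> (\<lambda>y. - d i y) y" by fast+
        then show ?thesis by (simp add: d_def)
      qed
      then have "G (pull y) = y" using y by (intro Rspace_eqI[of _ m]) (auto simp: G_def)
      then show "y \<in> G ` T" using 1 by (metis imageI)
    qed
    show "\<bar>Poly_Mapping.lookup y i\<bar> \<le> (\<Sum>i<m. \<bar>B i\<bar>)" if y: "y \<in> G ` T" and i: "i < m" for y i
    proof -
      obtain x where x: "x \<in> T" "y = G x" using y by blast
      have "\<bar>Poly_Mapping.lookup y i\<bar> = \<bar>g i x\<bar>" using x i by (simp add: G_def)
      also have "\<dots> \<le> \<bar>B i\<bar>" using B x(1) i by force
      also have "\<dots> \<le> (\<Sum>i<m. \<bar>B i\<bar>)" using i member_le_sum[of i "{..<m}" "\<lambda>i. \<bar>B i\<bar>"] by simp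
      finally show ?thesis .
    qed
  qed
  then show ?thesis unfolding G_def .
qed

section \<open>Z-maps by finite covers\<close>

lemma integer_affine_on_iff:
  "integer_affine_on n m T f \<longleftrightarrow>
     (\<exists>g. (\<forall>i<m. integer_form n (g i)) \<and> (\<forall>x\<in>T. f x = point_of m (\<lambda>i. g i x)))"
proof
  assume "integer_affine_on n m T f"
  then obtain M :: "nat \<Rightarrow> nat \<Rightarrow> int" and b :: "nat \<Rightarrow> int" where Mb: "\<forall>x\<in>T. f x \<in> Rspace m \<and>
      (\<forall>i<m. Poly_Mapping.lookup (f x) i = (\<Sum>j<n. of_int (M i j) * Poly_Mapping.lookup x j) + of_int (b i))"
    unfolding integer_affine_on_def by blast
  define g where "g i x = (\<Sum>j<n. of_int (M i j) * Poly_Mapping.lookup x j) + of_int (b i)" for i and x :: point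
  have "integer_form n (g i)" for i
    unfolding affine_form_def g_def by (intro exI[of _ "\<lambda>j. of_int (M i j)"] exI[of _ "of_int (b i)"]) auto
  moreover have "f x = point_of m (\<lambda>i. g i x)" if "x \<in> T" for x
    using Mb that by (intro Rspace_eqI[of _ m]) (auto simp: g_def)
  ultimately show "\<exists>g. (\<forall>i<m. integer_form n (g i)) \<and> (\<forall>x\<in>T. f x = point_of m (\<lambda>i. g i x))" by blast
next
  assume "\<exists>g. (\<forall>i<m. integer_form n (g i)) \<and> (\<forall>x\<in>T. f x = point_of m (\<lambda>i. g i x))"
  then obtain g where g: "\<forall>i<m. integer_form n (g i)" and f: "\<forall>x\<in>T. f x = point_of m (\<lambda>i. g i x)" by blast
  have "\<exists>(M :: nat \<Rightarrow> int) (b :: int). \<forall>x. g i x = (\<Sum>j<n. of_int (M j) * Poly_Mapping.lookup x j) + of_int b"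
    if i: "i < m" for i
  proof -
    obtain a c where ac: "\<forall>j<n. a j \<in> \<int>" "c \<in> \<int>" and gi: "g i = (\<lambda>x. (\<Sum>j<n. a j * Poly_Mapping.lookup x j) + c)"
      using g i unfolding affine_form_def by blast
    have "(\<Sum>j<n. of_int \<lfloor>a j\<rfloor> * Poly_Mapping.lookup x j) = (\<Sum>j<n. a j * Poly_Mapping.lookup x j)" for x :: point
      using ac(1) by (intro sum.cong) (auto simp: of_int_floor_cancel Ints_def)
    moreover have "of_int \<lfloor>c\<rfloor> = c" using ac(2) by (auto simp: Ints_def)
    ultimately show ?thesis
      unfolding gi by (intro exI[of _ "\<lambda>j. \<lfloor>a j\<rfloor>"] exI[of _ "\<lfloor>c\<rfloor>"]) presburger
  qed
  then obtain M :: "nat \<Rightarrow> nat \<Rightarrow> int" and b :: "nat \<Rightarrow> int"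
    where "\<And>i x. i < m \<Longrightarrow> g i x = (\<Sum>j<n. of_int (M i j) * Poly_Mapping.lookup x j) + of_int (b i)"
    by metis
  then show "integer_affine_on n m T f"
    unfolding integer_affine_on_def using f by (intro exI[of _ M] exI[of _ b]) auto
qed

lemma integer_affine_on_subset: "integer_affine_on n m T f \<Longrightarrow> S \<subseteq> T \<Longrightarrow> integer_affine_on n m S f"
  unfolding integer_affine_on_iff by blast

text \<open>
  Together with the next rule this replaces triangulations by finite covers: the members of a cover may
  overlap in any way, and the refining triangulation turns them into a simplicial complex.
\<close>

lemma ZmapI:
  assumes "finite F" "\<And>T. T \<in> F \<Longrightarrow> rational_polytope n T" "\<And>T. T \<in> F \<Longrightarrow> integer_affine_on n m T f" "P = \<Union>F"
  shows "Zmap n P m f"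
proof -
  obtain \<Delta> where \<Delta>: "rational_triangulation n (\<Union>F) \<Delta>" "\<forall>T\<in>\<Delta>. T \<noteq> {} \<longrightarrow> (\<exists>U\<in>F. T \<subseteq> U)"
    using triangulation_refining[of F "{}" n] assms(1,2) by blast
  have "integer_affine_on n m T f" if T: "T \<in> \<Delta>" for T
  proof (cases "T = {}")
    case False
    obtain U where U: "U \<in> F" "T \<subseteq> U" using bspec[OF \<Delta>(2) T] False by blast
    show ?thesis by (rule integer_affine_on_subset[OF assms(3)[OF U(1)] U(2)])
  qed (simp add: integer_affine_on_def)
  moreover have "rational_polyhedron n P"
    unfolding rational_polyhedron_def using \<Delta>(1) assms(4) 
    by (intro exI[of _ \<Delta>]) (auto simp: rational_triangulation_def)
  ultimately show ?thesis unfolding Zmap_def using \<Delta>(1) assms(4) by blast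
qed

lemma ZmapE:
  assumes "Zmap n P m f"
  obtains F where "finite F" "\<And>T. T \<in> F \<Longrightarrow> rational_polytope n T" "\<And>T. T \<in> F \<Longrightarrow> integer_affine_on n m T f" "P = \<Union>F"
proof -
  obtain \<Delta> where \<Delta>: "rational_triangulation n P \<Delta>" "\<forall>T\<in>\<Delta>. integer_affine_on n m T f"
    using assms unfolding Zmap_def by blast
  then have "finite \<Delta>" "\<And>T. T \<in> \<Delta> \<Longrightarrow> rational_polytope n T" "P = \<Union>\<Delta>"
    unfolding rational_triangulation_def using rational_simplex_polytope by blast+
  then show ?thesis using that \<Delta>(2) by blast
qed

lemma rational_polyhedronE:
  assumes "rational_polyhedron n P"
  obtains F where "finite F" "\<And>T. T \<in> F \<Longrightarrow> rational_polytope n T" "P = \<Union>F"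
  using assms rational_simplex_polytope unfolding rational_polyhedron_def by blast

lemma Zmap_polyhedron: "Zmap n P m f \<Longrightarrow> rational_polyhedron n P"
  by (simp add: Zmap_def)

lemma Zmap_Rspace: "Zmap n P m f \<Longrightarrow> x \<in> P \<Longrightarrow> f x \<in> Rspace m"
  by (elim ZmapE) (auto simp: integer_affine_on_def)

lemma Zmap_dom_Rspace: "Zmap n P m f \<Longrightarrow> x \<in> P \<Longrightarrow> x \<in> Rspace n"
  using rational_polytope_subset by (elim ZmapE) blast

lemma Zmap_cong:
  assumes "Zmap n P m f" "\<And>x. x \<in> P \<Longrightarrow> f x = g x"
  shows "Zmap n P m g"
proof -
  obtain F where F: "finite F" "\<And>T. T \<in> F \<Longrightarrow> rational_polytope n T" "\<And>T. T \<in> F \<Longrightarrow> integer_affine_on n m T f" "P = \<Union>F"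
    using assms(1) by (rule ZmapE) blast
  show ?thesis
  proof (rule ZmapI[OF F(1,2)])
    show "integer_affine_on n m T g" if "T \<in> F" for T
    proof -
      have "\<forall>x\<in>T. f x = g x" using that F(4) assms(2) by blast
      then show ?thesis using F(3)[OF that] unfolding integer_affine_on_def by simp
    qed
  qed (use F(4) in auto)
qed

lemma Zmap_compose:
  assumes "Zmap n P m f" "Zmap m Q k g" "f ` P \<subseteq> Q"
  shows "Zmap n P k (\<lambda>x. g (f x))"
proof -
  obtain F where F: "finite F" "\<And>T. T \<in> F \<Longrightarrow> rational_polytope n T" "\<And>T. T \<in> F \<Longrightarrow> integer_affine_on n m T f" "P = \<Union>F"
    using assms(1) by (rule ZmapE) blast
  obtain G where G: "finite G" "\<And>T. T \<in> G \<Longrightarrow> rational_polytope m T" "\<And>T. T \<in> G \<Longrightarrow> integer_affine_on m k T g" "Q = \<Union>G"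
    using assms(2) by (rule ZmapE) blast
  have *: "rational_polytope n {x \<in> T. f x \<in> U} \<and> integer_affine_on n k {x \<in> T. f x \<in> U} (\<lambda>x. g (f x))" 
    if T: "T \<in> F" and U: "U \<in> G" for T U
  proof -
    obtain a where a: "\<forall>i<m. integer_form n (a i)" "\<forall>x\<in>T. f x = point_of m (\<lambda>i. a i x)"
      using F(3)[OF T] unfolding integer_affine_on_iff by blast
    obtain b where b: "\<forall>i<k. integer_form m (b i)" "\<forall>x\<in>U. g x = point_of k (\<lambda>i. b i x)"
      using G(3)[OF U] unfolding integer_affine_on_iff by blast
    have eq: "{x \<in> T. f x \<in> U} = {x \<in> T. point_of m (\<lambda>i. a i x) \<in> U}" using a(2) by auto
    have "rational_polytope n {x \<in> T. point_of m (\<lambda>i. a i x) \<in> U}"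
      using a(1) integer_form_imp_rational_form by (intro rational_polytope_preimage F(2) G(2) T U) auto
    moreover have "integer_affine_on n k {x \<in> T. f x \<in> U} (\<lambda>x. g (f x))"
      unfolding integer_affine_on_iff
    proof (intro exI conjI)
      show "\<forall>i<k. integer_form n (\<lambda>x. b i (point_of m (\<lambda>i. a i x)))"
        using a(1) b(1) by (auto intro: integer_form_compose)
      show "\<forall>x\<in>{x \<in> T. f x \<in> U}. g (f x) = point_of k (\<lambda>i. b i (point_of m (\<lambda>i. a i x)))"
      proof
        fix x assume "x \<in> {x \<in> T. f x \<in> U}"
        then have "f x = point_of m (\<lambda>i. a i x)" "g (f x) = point_of k (\<lambda>i. b i (f x))" using a(2) b(2) by blast+
        then show "g (f x) = point_of k (\<lambda>i. b i (point_of m (\<lambda>i. a i x)))" by metis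
      qed
    qed
    ultimately show ?thesis unfolding eq by blast
  qed
  show ?thesis
  proof (rule ZmapI[of "(\<lambda>(T, U). {x \<in> T. f x \<in> U}) ` (F \<times> G)"])
    show "P = \<Union> ((\<lambda>(T, U). {x \<in> T. f x \<in> U}) ` (F \<times> G))" using F(4) G(4) assms(3) by fastforce
  qed (use F(1) G(1) * in auto)
qed

lemma Zmap_UN:
  assumes "finite I" "\<And>i. i \<in> I \<Longrightarrow> Zmap n (P i) m f"
  shows "Zmap n (\<Union>i\<in>I. P i) m f"
proof -
  have "\<forall>i\<in>I. \<exists>F. finite F \<and> (\<forall>T\<in>F. rational_polytope n T \<and> integer_affine_on n m T f) \<and> P i = \<Union>F"
    using assms(2) by (meson ZmapE)
  from bchoice[OF this] obtain F where F: "\<forall>i\<in>I. finite (F i) \<and> 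
      (\<forall>T\<in>F i. rational_polytope n T \<and> integer_affine_on n m T f) \<and> P i = \<Union>(F i)" ..
  show ?thesis by (rule ZmapI[of "\<Union>i\<in>I. F i"]) (use assms(1) F in auto)
qed

text \<open>
  In particular the image is a rational polyhedron, being the domain of a Z-map.
\<close>

lemma Zmap_left_inverse:
  assumes f: "Zmap n P m f" and p: "\<And>j. j < n \<Longrightarrow> integer_form m (p j)"
    and inv: "\<And>x. x \<in> P \<Longrightarrow> point_of n (\<lambda>j. p j (f x)) = x"
  shows "Zmap m (f ` P) n (\<lambda>y. point_of n (\<lambda>j. p j y))"
proof -
  obtain F where F: "finite F" "\<And>T. T \<in> F \<Longrightarrow> rational_polytope n T" "\<And>T. T \<in> F \<Longrightarrow> integer_affine_on n m T f" "P = \<Union>F"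
    using f by (rule ZmapE) blast
  show ?thesis
  proof (rule ZmapI[of "(\<lambda>T. f ` T) ` F"])
    fix S assume "S \<in> (\<lambda>T. f ` T) ` F"
    then obtain T where T: "T \<in> F" "S = f ` T" by blast
    obtain a where a: "\<forall>i<m. integer_form n (a i)" "\<forall>x\<in>T. f x = point_of m (\<lambda>i. a i x)"
      using F(3)[OF T(1)] unfolding integer_affine_on_iff by blast
    have "S = (\<lambda>x. point_of m (\<lambda>i. a i x)) ` T" using T(2) a(2) by auto
    moreover have "rational_polytope m ((\<lambda>x. point_of m (\<lambda>i. a i x)) ` T)"
    proof (rule rational_polytope_image[OF F(2)[OF T(1)], where p = p])
      show "point_of n (\<lambda>j. p j (point_of m (\<lambda>i. a i x))) = x" if "x \<in> T" for x
        using inv[of x] that a(2) T(1) F(4) by auto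
    qed (use a(1) p integer_form_imp_rational_form in auto)
    ultimately show "rational_polytope m S" by simp
    show "integer_affine_on m n S (\<lambda>y. point_of n (\<lambda>j. p j y))"
      unfolding integer_affine_on_iff using p by blast
  qed (use F(1,4) in auto)
qed

section \<open>Lattice combinations of integer forms\<close>

definition ordered_on :: "(point \<Rightarrow> real) set \<Rightarrow> point set \<Rightarrow> bool" where
  "ordered_on L T \<longleftrightarrow> (\<forall>l\<in>L. \<forall>l'\<in>L. (\<forall>x\<in>T. l x \<le> l' x) \<or> (\<forall>x\<in>T. l' x \<le> l x))"

text \<open>
  Piecewise integer affine functions, in a form that makes closure under addition, maxima and minima
  easy. The set \<open>L\<close> collects enough integer forms to decide all comparisons: wherever \<open>L\<close> is totally ordered by the pointwise order, the
  function is a single member of \<open>L\<close>. The case of empty \<open>T\<close> makes \<open>L\<close> nonempty.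
\<close>

definition lattice_form :: "nat \<Rightarrow> (point \<Rightarrow> real) \<Rightarrow> bool" where
  "lattice_form n g \<longleftrightarrow>
     (\<exists>L. finite L \<and> (\<forall>l\<in>L. integer_form n l) \<and>
          (\<forall>T. ordered_on L T \<longrightarrow> (\<exists>l\<in>L. \<forall>x\<in>T. g x = l x)))"

lemma ordered_on_empty: "ordered_on L {}"
  by (simp add: ordered_on_def)

lemma ordered_on_subset: "ordered_on L T \<Longrightarrow> L' \<subseteq> L \<Longrightarrow> ordered_on L' T"
  unfolding ordered_on_def by blast

lemma lattice_formI:
  assumes "finite L" "\<And>l. l \<in> L \<Longrightarrow> integer_form n l"
    and "\<And>T. ordered_on L T \<Longrightarrow> \<exists>l\<in>L. \<forall>x\<in>T. g x = l x"
  shows "lattice_form n g"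
  unfolding lattice_form_def using assms by (intro exI[of _ L]) blast

lemma lattice_formE:
  assumes "lattice_form n g"
  obtains L where "finite L" "\<And>l. l \<in> L \<Longrightarrow> integer_form n l"
    "\<And>T. ordered_on L T \<Longrightarrow> \<exists>l\<in>L. \<forall>x\<in>T. g x = l x"
  using assms unfolding lattice_form_def by blast

lemma lattice_form_integer_form: "integer_form n l \<Longrightarrow> lattice_form n l"
  by (rule lattice_formI[of "{l}"]) auto

lemma lattice_form_coord: "i < n \<Longrightarrow> lattice_form n (\<lambda>x. Poly_Mapping.lookup x i)"
  by (rule lattice_form_integer_form[OF integer_form_coord])

lemma lattice_form_const: "c \<in> \<int> \<Longrightarrow> lattice_form n (\<lambda>x. c)"
  by (rule lattice_form_integer_form[OF integer_form_const])

lemma lattice_form_max: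
  assumes "lattice_form n f" "lattice_form n g"
  shows "lattice_form n (\<lambda>x. max (f x) (g x))"
proof -
  obtain L where L: "finite L" "\<And>l. l \<in> L \<Longrightarrow> integer_form n l"
    "\<And>T. ordered_on L T \<Longrightarrow> \<exists>l\<in>L. \<forall>x\<in>T. f x = l x"
    using assms(1) by (rule lattice_formE) blast
  obtain M where M: "finite M" "\<And>l. l \<in> M \<Longrightarrow> integer_form n l"
    "\<And>T. ordered_on M T \<Longrightarrow> \<exists>l\<in>M. \<forall>x\<in>T. g x = l x"
    using assms(2) by (rule lattice_formE) blast
  show ?thesis
  proof (rule lattice_formI[of "L \<union> M"])
    fix T :: "point set"
    assume ord: "ordered_on (L \<union> M) T"
    obtain l where l: "l \<in> L" "\<forall>x\<in>T. f x = l x" using L(3) ordered_on_subset[OF ord] by blast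
    obtain m where m: "m \<in> M" "\<forall>x\<in>T. g x = m x" using M(3) ordered_on_subset[OF ord] by blast
    have "(\<forall>x\<in>T. l x \<le> m x) \<or> (\<forall>x\<in>T. m x \<le> l x)" using ord l(1) m(1) unfolding ordered_on_def by blast
    then have "(\<forall>x\<in>T. max (f x) (g x) = m x) \<or> (\<forall>x\<in>T. max (f x) (g x) = l x)"
      using l(2) m(2) by (metis max.absorb1 max.absorb2)
    then show "\<exists>l\<in>L \<union> M. \<forall>x\<in>T. max (f x) (g x) = l x" using l(1) m(1) by blast
  qed (use L(1,2) M(1,2) in auto)
qed

text \<open>
  The sums of two forms suffice as decision set: fixing one summand, an order on the sums is an order on
  each of the two sets.
\<close>

lemma lattice_form_add:
  assumes "lattice_form n f" "lattice_form n g"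
  shows "lattice_form n (\<lambda>x. f x + g x)"
proof -
  obtain L where L: "finite L" "\<And>l. l \<in> L \<Longrightarrow> integer_form n l"
    "\<And>T. ordered_on L T \<Longrightarrow> \<exists>l\<in>L. \<forall>x\<in>T. f x = l x"
    using assms(1) by (rule lattice_formE) blast
  obtain M where M: "finite M" "\<And>l. l \<in> M \<Longrightarrow> integer_form n l"
    "\<And>T. ordered_on M T \<Longrightarrow> \<exists>l\<in>M. \<forall>x\<in>T. g x = l x"
    using assms(2) by (rule lattice_formE) blast
  obtain l0 where l0: "l0 \<in> L" using L(3)[OF ordered_on_empty] by blast
  obtain m0 where m0: "m0 \<in> M" using M(3)[OF ordered_on_empty] by blast
  define S where "S = (\<lambda>(l, m) x. l x + m x) ` (L \<times> M)"
  have S: "(\<lambda>x. l x + m x) \<in> S" if "l \<in> L" "m \<in> M" for l m unfolding S_def using that by force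
  show ?thesis
  proof (rule lattice_formI[of S])
    show "finite S" using L(1) M(1) by (simp add: S_def)
    show "integer_form n l" if "l \<in> S" for l using that L(2) M(2) by (auto simp: S_def intro: integer_form_add)
    fix T :: "point set"
    assume ord: "ordered_on (S) T"
    have "(\<forall>x\<in>T. l x \<le> l' x) \<or> (\<forall>x\<in>T. l' x \<le> l x)" if "l \<in> L" "l' \<in> L" for l l'
      using bspec[OF bspec[OF ord[unfolded ordered_on_def] S[OF that(1) m0]] S[OF that(2) m0]] by simp
    then have "ordered_on L T" unfolding ordered_on_def by blast
    then obtain l where l: "l \<in> L" "\<forall>x\<in>T. f x = l x" using L(3) by blast
    have "(\<forall>x\<in>T. m x \<le> m' x) \<or> (\<forall>x\<in>T. m' x \<le> m x)" if "m \<in> M" "m' \<in> M" for m m'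
      using bspec[OF bspec[OF ord[unfolded ordered_on_def] S[OF l0 that(1)]] S[OF l0 that(2)]] by simp
    then have "ordered_on M T" unfolding ordered_on_def by blast
    then obtain m where m: "m \<in> M" "\<forall>x\<in>T. g x = m x" using M(3) by blast
    show "\<exists>l\<in>S. \<forall>x\<in>T. f x + g x = l x" using S[OF l(1) m(1)] l(2) m(2) by (intro bexI) auto
  qed
qed

lemma lattice_form_uminus:
  assumes "lattice_form n f"
  shows "lattice_form n (\<lambda>x. - f x)"
proof -
  obtain L where L: "finite L" "\<And>l. l \<in> L \<Longrightarrow> integer_form n l"
    "\<And>T. ordered_on L T \<Longrightarrow> \<exists>l\<in>L. \<forall>x\<in>T. f x = l x"
    using assms(1) by (rule lattice_formE) blast
  define N where "N = (\<lambda>l x. - l x :: real) ` L"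
  have N: "(\<lambda>x. - l x) \<in> N" if "l \<in> L" for l unfolding N_def using that by blast
  show ?thesis
  proof (rule lattice_formI[of N])
    show "finite N" using L(1) by (simp add: N_def)
    show "integer_form n l" if "l \<in> N" for l using that L(2) by (auto simp: N_def intro: integer_form_uminus)
    fix T :: "point set"
    assume ord: "ordered_on (N) T"
    have "(\<forall>x\<in>T. l x \<le> l' x) \<or> (\<forall>x\<in>T. l' x \<le> l x)" if "l \<in> L" "l' \<in> L" for l l'
      using bspec[OF bspec[OF ord[unfolded ordered_on_def] N[OF that(1)]] N[OF that(2)]] by auto
    then have "ordered_on L T" unfolding ordered_on_def by blast
    then obtain l where l: "l \<in> L" "\<forall>x\<in>T. f x = l x" using L(3) by blast
    show "\<exists>l\<in>N. \<forall>x\<in>T. - f x = l x" using N[OF l(1)] l(2) by (intro bexI) auto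
  qed
qed

lemma lattice_form_diff: "lattice_form n f \<Longrightarrow> lattice_form n g \<Longrightarrow> lattice_form n (\<lambda>x. f x - g x)"
  using lattice_form_add[of n f "\<lambda>x. - g x"] lattice_form_uminus[of n g] by simp

lemma lattice_form_min:
  assumes "lattice_form n f" "lattice_form n g"
  shows "lattice_form n (\<lambda>x. min (f x) (g x))"
proof -
  have "lattice_form n (\<lambda>x. - max (- f x) (- g x))"
    using assms by (intro lattice_form_uminus lattice_form_max)
  moreover have "- max (- f x) (- g x) = min (f x) (g x)" for x by (simp add: max_def min_def)
  ultimately show ?thesis by simp
qed

lemma lattice_form_multiple: "lattice_form n f \<Longrightarrow> lattice_form n (\<lambda>x. of_nat N * f x)"
proof (induction N)
  case 0
  show ?case by (simp add: lattice_form_const)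
next
  case (Suc N)
  then show ?case using lattice_form_add[of n f "\<lambda>x. of_nat N * f x"] by (simp add: algebra_simps)
qed

lemma lattice_form_Max:
  assumes "finite I" "I \<noteq> {}" "\<And>i. i \<in> I \<Longrightarrow> lattice_form n (g i)"
  shows "lattice_form n (\<lambda>x. Max ((\<lambda>i. g i x) ` I))"
  using assms
proof (induction rule: finite_ne_induct)
  case (insert i I)
  then show ?case using lattice_form_max[of n "g i" "\<lambda>x. Max ((\<lambda>i. g i x) ` I)"] by simp
qed simp

text \<open>
  Refining by the signs of all differences of the forms involved makes them totally ordered on each
  simplex.
\<close>

lemma triangulation_lattice_forms:
  assumes "finite F" "\<And>T. T \<in> F \<Longrightarrow> rational_polytope n T" "\<And>i. i \<in> I \<Longrightarrow> lattice_form n (g i)" "finite I"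
  obtains \<Delta> where "rational_triangulation n (\<Union>F) \<Delta>"
    "\<And>T i. T \<in> \<Delta> \<Longrightarrow> i \<in> I \<Longrightarrow> \<exists>l. integer_form n l \<and> (\<forall>x\<in>T. g i x = l x)"
proof -
  have "\<forall>i\<in>I. \<exists>L. finite L \<and> (\<forall>l\<in>L. integer_form n l) \<and>
          (\<forall>T. ordered_on L T \<longrightarrow> (\<exists>l\<in>L. \<forall>x\<in>T. g i x = l x))"
    using assms(3) unfolding lattice_form_def by blast
  from bchoice[OF this] obtain L where L: "\<forall>i\<in>I. finite (L i) \<and> (\<forall>l\<in>L i. integer_form n l) \<and>
          (\<forall>T. ordered_on (L i) T \<longrightarrow> (\<exists>l\<in>L i. \<forall>x\<in>T. g i x = l x))" ..
  define G where "G = (\<Union>i\<in>I. (\<lambda>(l, l') x. l x - l' x) ` (L i \<times> L i))"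
  have finG: "finite G" unfolding G_def using L assms(4) by auto
  have G: "rational_form n h" if h: "h \<in> G" for h
  proof -
    obtain i l l' where "i \<in> I" "l \<in> L i" "l' \<in> L i" "h = (\<lambda>x. l x - l' x)"
      using h unfolding G_def by auto
    then show ?thesis using L by (auto intro!: integer_form_diff integer_form_imp_rational_form)
  qed
  obtain \<Delta> where \<Delta>: "rational_triangulation n (\<Union>F) \<Delta>"
    "\<forall>T\<in>\<Delta>. \<forall>g\<in>G. (\<forall>x\<in>T. 0 \<le> g x) \<or> (\<forall>x\<in>T. g x \<le> 0)"
    using triangulation_refining[OF assms(1) finG assms(2) G] by blast
  have "\<exists>l. integer_form n l \<and> (\<forall>x\<in>T. g i x = l x)" if T: "T \<in> \<Delta>" and i: "i \<in> I" for T i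
  proof -
    have "(\<forall>x\<in>T. l x \<le> l' x) \<or> (\<forall>x\<in>T. l' x \<le> l x)" if l: "l \<in> L i" "l' \<in> L i" for l l'
    proof -
      have "(\<lambda>x. l x - l' x) \<in> G" using l i unfolding G_def by force
      from bspec[OF bspec[OF \<Delta>(2) T] this] show ?thesis by auto
    qed
    then have "ordered_on (L i) T" unfolding ordered_on_def by blast
    then show ?thesis using bspec[OF L i] by blast
  qed
  then show ?thesis using that \<Delta>(1) by blast
qed

lemma lattice_forms_Zmap:
  assumes "rational_polyhedron n P" "\<And>i. i < m \<Longrightarrow> lattice_form n (g i)"
  shows "Zmap n P m (\<lambda>x. point_of m (\<lambda>i. g i x))"
proof -
  obtain F where F: "finite F" "\<And>T. T \<in> F \<Longrightarrow> rational_polytope n T" "P = \<Union>F"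
    using assms(1) by (rule rational_polyhedronE) (rule that)
  obtain \<Delta> where \<Delta>: "rational_triangulation n (\<Union>F) \<Delta>"
    "\<And>T i. T \<in> \<Delta> \<Longrightarrow> i \<in> {..<m} \<Longrightarrow> \<exists>l. integer_form n l \<and> (\<forall>x\<in>T. g i x = l x)"
    by (rule triangulation_lattice_forms[OF F(1,2), of "{..<m}" g]) (use assms(2) in auto)
  have "integer_affine_on n m T (\<lambda>x. point_of m (\<lambda>i. g i x))" if T: "T \<in> \<Delta>" for T
  proof -
    have "\<forall>i\<in>{..<m}. \<exists>l. integer_form n l \<and> (\<forall>x\<in>T. g i x = l x)" using \<Delta>(2)[OF T] by blast
    from bchoice[OF this] obtain l where l: "\<forall>i\<in>{..<m}. integer_form n (l i) \<and> (\<forall>x\<in>T. g i x = l i x)" ..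
    have "point_of m (\<lambda>i. g i x) = point_of m (\<lambda>i. l i x)" if "x \<in> T" for x
      using l that by (intro Rspace_eqI[of _ m]) auto
    then show ?thesis unfolding integer_affine_on_iff using l by (intro exI[of _ l]) auto
  qed
  then show ?thesis unfolding Zmap_def using assms(1) \<Delta>(1) F(3) by blast
qed

section \<open>Extension of Z-maps to the ambient space\<close>

text \<open>
  The largest violation of the defining inequalities, after clearing denominators.
\<close>

lemma polytope_distance_form:
  assumes "rational_polytope n T"
  obtains d where "lattice_form n d" "\<And>x. x \<in> Rspace n \<Longrightarrow> 0 \<le> d x" "\<And>x. x \<in> Rspace n \<Longrightarrow> d x = 0 \<longleftrightarrow> x \<in> T"
proof -
  obtain H where H: "finite H" "\<And>h. h \<in> H \<Longrightarrow> rational_form n h"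
    "\<And>x. x \<in> T \<longleftrightarrow> x \<in> Rspace n \<and> (\<forall>h\<in>H. 0 \<le> h x)"
    using assms by (rule rational_polytopeE) (rule that)
  have "\<forall>h\<in>H. \<exists>c::int. 0 < c \<and> integer_form n (\<lambda>x. of_int c * h x)"
    using rational_form_integer_multiple[OF H(2)] by metis
  from bchoice[OF this] obtain c :: "(point \<Rightarrow> real) \<Rightarrow> int"
    where c: "\<forall>h\<in>H. 0 < c h \<and> integer_form n (\<lambda>x. of_int (c h) * h x)" ..
  define J where "J = insert (\<lambda>x. 0) ((\<lambda>h x. - (of_int (c h) * h x)) ` H)"
  define d where "d x = Max ((\<lambda>j. j x) ` J)" for x :: point
  have J: "finite J" "J \<noteq> {}" using H(1) by (auto simp: J_def)
  show ?thesis
  proof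
    have "integer_form n j" if "j \<in> J" for j 
      using that c by (auto simp: J_def intro: integer_form_uminus integer_form_const)
    then show "lattice_form n d" unfolding d_def
      using J by (intro lattice_form_Max lattice_form_integer_form) auto
    have le: "j x \<le> d x" if "j \<in> J" for j x unfolding d_def using J that by (intro Max_ge) auto
    show pos: "0 \<le> d x" for x using le[of "\<lambda>x. 0"] by (simp add: J_def)
    show "d x = 0 \<longleftrightarrow> x \<in> T" if x: "x \<in> Rspace n" for x
    proof
      assume d0: "d x = 0"
      have "0 \<le> h x" if h: "h \<in> H" for h
      proof -
        have "- (of_int (c h) * h x) \<le> 0" using le[of "\<lambda>x. - (of_int (c h) * h x)" x] h d0 by (simp add: J_def)
        then show ?thesis using bspec[OF c h] by (simp add: zero_le_mult_iff)
      qed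
      then show "x \<in> T" using H(3) x by blast
    next
      assume "x \<in> T"
      then have h: "0 \<le> of_int (c h) * h x" if "h \<in> H" for h using H(3) bspec[OF c that] that by simp
      have "d x \<le> 0" unfolding d_def using J h by (subst Max_le_iff) (auto simp: J_def)
      then show "d x = 0" using pos[of x] by simp
    qed
  qed
qed

text \<open>
  The minimum of the corresponding functions of the pieces; the empty polyhedron gets the constant 1.
\<close>

lemma polyhedron_zero_form:
  assumes "rational_polyhedron n P"
  shows "\<exists>d. lattice_form n d \<and> (\<forall>x\<in>Rspace n. d x = 0 \<longleftrightarrow> x \<in> P)"
proof -
  obtain F where F: "finite F" "\<And>T. T \<in> F \<Longrightarrow> rational_polytope n T" "P = \<Union>F"
    using assms(1) by (rule rational_polyhedronE) (rule that)
  have "\<exists>d. lattice_form n d \<and> (\<forall>x\<in>Rspace n. 0 \<le> d x \<and> (d x = 0 \<longleftrightarrow> x \<in> \<Union>F))"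
    using F(1,2)
  proof (induction rule: finite_induct)
    case empty
    show ?case
      by (rule exI[of _ "\<lambda>x. 1"]) (auto simp: lattice_form_const)
  next
    case (insert T F)
    obtain d where d: "lattice_form n d" "\<forall>x\<in>Rspace n. 0 \<le> d x \<and> (d x = 0 \<longleftrightarrow> x \<in> \<Union>F)"
      using insert by blast
    obtain e where e: "lattice_form n e" "\<And>x. x \<in> Rspace n \<Longrightarrow> 0 \<le> e x" "\<And>x. x \<in> Rspace n \<Longrightarrow> e x = 0 \<longleftrightarrow> x \<in> T"
      by (rule polytope_distance_form[of n T]) (use insert.prems in auto)
    have "0 \<le> min (e x) (d x) \<and> (min (e x) (d x) = 0 \<longleftrightarrow> x \<in> \<Union>(insert T F))" if x: "x \<in> Rspace n" for x
      using bspec[OF d(2) x] e(2,3)[OF x] by (auto simp: min_def)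
    then show ?case using lattice_form_min[OF e(1) d(1)] by blast
  qed
  then show ?thesis using F(3) by blast
qed

text \<open>
  On a simplex where \<open>d\<close> is affine the inequality needs to hold at the vertices only, and there it holds
  for large \<open>N\<close> because \<open>e\<close> is not positive at vertices where \<open>d\<close> vanishes.
\<close>

lemma domination_on_polytope:
  assumes T: "rational_polytope n T" and d: "lattice_form n d" and e: "integer_form n e"
    and nonneg: "\<And>x. x \<in> T \<Longrightarrow> 0 \<le> d x" and zero: "\<And>x. x \<in> T \<Longrightarrow> d x = 0 \<Longrightarrow> e x \<le> 0"
  shows "\<forall>\<^sub>F N in sequentially. \<forall>x\<in>T. e x \<le> of_nat N * d x"
proof -
  obtain \<Delta> where \<Delta>: "rational_triangulation n (\<Union>{T}) \<Delta>"
    "\<And>S i. S \<in> \<Delta> \<Longrightarrow> i \<in> {()} \<Longrightarrow> \<exists>l. integer_form n l \<and> (\<forall>x\<in>S. d x = l x)"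
    by (rule triangulation_lattice_forms[of "{T}" n "{()}" "\<lambda>_. d"]) (use T d in auto)
  have fin: "finite \<Delta>" and un: "\<Union>\<Delta> = T" using \<Delta>(1) unfolding rational_triangulation_def by auto
  have "\<forall>\<^sub>F N in sequentially. \<forall>x\<in>S. e x \<le> of_nat N * d x" if S: "S \<in> \<Delta>" for S
  proof -
    obtain V where V: "finite V" "S = convex hull V"
    proof -
      have "rational_simplex n S" using \<Delta>(1) S unfolding rational_triangulation_def by simp
      then show ?thesis using that unfolding rational_simplex_def by (elim exE conjE) (rule that)
    qed
    obtain l where l: "integer_form n l" "\<forall>x\<in>S. d x = l x" using \<Delta>(2)[OF S] by blast
    have VS: "V \<subseteq> S" unfolding V(2) by (rule hull_subset)
    have "\<forall>\<^sub>F N in sequentially. e v \<le> of_nat N * l v" if v: "v \<in> V" for v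
    proof -
      have vT: "v \<in> T" "d v = l v" using v VS S un l(2) by auto
      show ?thesis
      proof (cases "l v = 0")
        case True
        then show ?thesis using zero[OF vT(1)] vT(2) by simp
      next
        case False
        then have pos: "0 < l v" using nonneg[OF vT(1)] vT(2) by simp
        have "\<forall>\<^sub>F N in sequentially. e v / l v \<le> of_nat N"
          using filterlim_real_sequentially by (simp add: filterlim_at_top)
        then show ?thesis by eventually_elim (use pos in \<open>simp add: pos_divide_le_eq\<close>)
      qed
    qed
    then have "\<forall>\<^sub>F N in sequentially. \<forall>v\<in>V. e v \<le> of_nat N * l v"
      using V(1) by (simp add: eventually_ball_finite)
    then show ?thesis
    proof eventually_elim
      case (elim N)
      have form: "integer_form n (\<lambda>x. of_nat N * l x - e x)"
        using l(1) e by (intro integer_form_diff integer_form_scale) auto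
      have "S \<subseteq> {x. 0 \<le> of_nat N * l x - e x}" unfolding V(2)
        using elim by (intro hull_minimal convex_form_nonneg[OF form]) auto
      then show ?case using l(2) by auto
    qed
  qed
  then have "\<forall>\<^sub>F N in sequentially. \<forall>S\<in>\<Delta>. \<forall>x\<in>S. e x \<le> of_nat N * d x"
    using fin by (simp add: eventually_ball_finite)
  then show ?thesis by eventually_elim (use un in blast)
qed

text \<open>
  The maximum over all pieces \<open>T\<close> of \<open>l\<^sub>T - N d\<^sub>T\<close>. At a point of a piece \<open>T'\<close>, the term of \<open>T'\<close> has the
  right value, and all other terms are dominated by it if \<open>N\<close> is large.
\<close>

lemma extend_piecewise_form:
  assumes F: "finite F" "\<And>T. T \<in> F \<Longrightarrow> rational_polytope n T"
    and f: "\<And>T. T \<in> F \<Longrightarrow> \<exists>l. integer_form n l \<and> (\<forall>x\<in>T. f x = l x)"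
  obtains g where "lattice_form n g" "\<And>x. x \<in> \<Union>F \<Longrightarrow> f x = g x"
proof (cases "F = {}")
  case True
  then show ?thesis using that[of "\<lambda>x. 0"] by (simp add: lattice_form_const)
next
  case False
  have "\<forall>T\<in>F. \<exists>l. integer_form n l \<and> (\<forall>x\<in>T. f x = l x)" using f by blast
  from bchoice[OF this] obtain l where l: "\<forall>T\<in>F. integer_form n (l T) \<and> (\<forall>x\<in>T. f x = l T x)" ..
  have "\<forall>T\<in>F. \<exists>d. lattice_form n d \<and> (\<forall>x\<in>Rspace n. 0 \<le> d x \<and> (d x = 0 \<longleftrightarrow> x \<in> T))"
    using F(2) polytope_distance_form by metis
  from bchoice[OF this] obtain d 
    where d: "\<forall>T\<in>F. lattice_form n (d T) \<and> (\<forall>x\<in>Rspace n. 0 \<le> d T x \<and> (d T x = 0 \<longleftrightarrow> x \<in> T))" ..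
  have inR: "x \<in> Rspace n" if "x \<in> T" "T \<in> F" for x T using that F(2) rational_polytope_subset by blast
  have "\<forall>\<^sub>F N in sequentially. \<forall>x\<in>T'. l T x - l T' x \<le> of_nat N * d T x" if T: "T \<in> F" and T': "T' \<in> F" for T T'
  proof (rule domination_on_polytope[OF F(2)[OF T']])
    show "lattice_form n (d T)" using d T by blast
    show "integer_form n (\<lambda>x. l T x - l T' x)" using l T T' by (intro integer_form_diff) auto
    show "0 \<le> d T x" if "x \<in> T'" for x using d T inR[OF that T'] by blast
    show "l T x - l T' x \<le> 0" if x: "x \<in> T'" and "d T x = 0" for x
    proof -
      have "x \<in> T" using d T inR[OF x T'] that by blast
      then have "f x = l T x" "f x = l T' x" using l T T' x by blast+
      then show ?thesis by simp
    qed
  qed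
  then have "\<forall>\<^sub>F N in sequentially. \<forall>T\<in>F. \<forall>T'\<in>F. \<forall>x\<in>T'. l T x - l T' x \<le> of_nat N * d T x"
    using F(1) by (simp add: eventually_ball_finite)
  from eventually_happens'[OF sequentially_bot this]
  obtain N where N: "\<forall>T\<in>F. \<forall>T'\<in>F. \<forall>x\<in>T'. l T x - l T' x \<le> of_nat N * d T x" ..
  define g where "g x = Max ((\<lambda>T. l T x - of_nat N * d T x) ` F)" for x
  show ?thesis
  proof (rule that[of g])
    have "lattice_form n (\<lambda>x. l T x - of_nat N * d T x)" if T: "T \<in> F" for T
      using bspec[OF l T] bspec[OF d T]
      by (intro lattice_form_diff lattice_form_multiple lattice_form_integer_form[of n "l T"]) blast+
    then show "lattice_form n g" unfolding g_def using F(1) False by (intro lattice_form_Max)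
    fix x assume "x \<in> \<Union>F"
    then obtain T' where T': "T' \<in> F" "x \<in> T'" by blast
    have fx: "f x = l T' x" using l T' by blast
    have "d T' x = 0" using d T' inR by blast
    then have "f x \<in> (\<lambda>T. l T x - of_nat N * d T x) ` F" using fx T'(1) by force
    moreover have "y \<le> f x" if "y \<in> (\<lambda>T. l T x - of_nat N * d T x) ` F" for y
      using that N T' fx by force
    ultimately show "f x = g x" unfolding g_def using F(1) by (intro Max_eqI[symmetric]) auto
  qed
qed

theorem Zmap_extension:
  assumes "Zmap n P m f"
  shows "\<exists>g. (\<forall>i<m. lattice_form n (g i)) \<and> (\<forall>x\<in>P. f x = point_of m (\<lambda>i. g i x))"
proof -
  obtain F where F: "finite F" "\<And>T. T \<in> F \<Longrightarrow> rational_polytope n T" "\<And>T. T \<in> F \<Longrightarrow> integer_affine_on n m T f" "P = \<Union>F"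
    using assms(1) by (rule ZmapE) (rule that)
  have "\<exists>g. lattice_form n g \<and> (\<forall>x\<in>P. Poly_Mapping.lookup (f x) i = g x)" if i: "i < m" for i
  proof (rule extend_piecewise_form[OF F(1,2), of "\<lambda>x. Poly_Mapping.lookup (f x) i"])
    fix T assume "T \<in> F"
    then obtain a where a: "\<forall>i<m. integer_form n (a i)" "\<forall>x\<in>T. f x = point_of m (\<lambda>i. a i x)"
      using F(3) unfolding integer_affine_on_iff by blast
    then show "\<exists>l. integer_form n l \<and> (\<forall>x\<in>T. Poly_Mapping.lookup (f x) i = l x)"
      using i by (intro exI[of _ "a i"]) auto
  qed (use F(4) in auto)
  then have "\<forall>i\<in>{..<m}. \<exists>g. lattice_form n g \<and> (\<forall>x\<in>P. Poly_Mapping.lookup (f x) i = g x)" by blast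
  from bchoice[OF this] obtain g 
    where g: "\<forall>i\<in>{..<m}. lattice_form n (g i) \<and> (\<forall>x\<in>P. Poly_Mapping.lookup (f x) i = g i x)" ..
  have "f x = point_of m (\<lambda>i. g i x)" if "x \<in> P" for x
    using g that Zmap_Rspace[OF assms that] by (intro Rspace_eqI[of _ m]) auto
  then show ?thesis using g by (intro exI[of _ g]) auto
qed

section \<open>Gluing polyhedra along Z-maps\<close>

text \<open>
  The left inverse is required to be the restriction of a single integer affine map on the target space;
  the projections of graph-like maps have this property.
\<close>

definition retractable :: "nat \<Rightarrow> point set \<Rightarrow> nat \<Rightarrow> (point \<Rightarrow> point) \<Rightarrow> bool" where
  "retractable n P m \<iota> \<longleftrightarrow>
     Zmap n P m \<iota> \<and>
     (\<exists>p. (\<forall>j<n. integer_form m (p j)) \<and> (\<forall>x\<in>P. point_of n (\<lambda>j. p j (\<iota> x)) = x))"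

text \<open>
  On the image of \<open>P\<^sub>i\<close> the glued map is \<open>f\<^sub>i\<close> after the left inverse of \<open>\<iota>\<^sub>i\<close>, hence a Z-map, and
  the covers of the images combine to a cover of their union.
\<close>

lemma glue_Zmaps:
  assumes "finite I" and \<iota>: "\<And>i. i \<in> I \<Longrightarrow> retractable (n i) (P i) m (\<iota> i)"
    and f: "\<And>i. i \<in> I \<Longrightarrow> Zmap (n i) (P i) k (f i)"
    and compat: "\<And>i j x y. \<lbrakk>i \<in> I; j \<in> I; x \<in> P i; y \<in> P j; \<iota> i x = \<iota> j y\<rbrakk> \<Longrightarrow> f i x = f j y"
  shows "\<exists>h. Zmap m (\<Union>i\<in>I. \<iota> i ` P i) k h \<and> (\<forall>i\<in>I. \<forall>x\<in>P i. h (\<iota> i x) = f i x)"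
proof -
  define h where "h y = (SOME z. \<exists>i\<in>I. \<exists>x\<in>P i. \<iota> i x = y \<and> f i x = z)" for y
  have h: "h (\<iota> i x) = f i x" if "i \<in> I" "x \<in> P i" for i x
    unfolding h_def by (rule some_equality) (use that compat in blast)+
  have "Zmap m (\<iota> i ` P i) k h" if i: "i \<in> I" for i
  proof -
    obtain p where p: "\<forall>j<n i. integer_form m (p j)" "\<forall>x\<in>P i. point_of (n i) (\<lambda>j. p j (\<iota> i x)) = x"
      using \<iota>[OF i] unfolding retractable_def by blast
    define r where "r y = point_of (n i) (\<lambda>j. p j y)" for y
    have r: "r (\<iota> i x) = x" if "x \<in> P i" for x unfolding r_def using p(2) that by blast
    have "Zmap m (\<iota> i ` P i) (n i) r"
      unfolding r_def using \<iota>[OF i] p by (intro Zmap_left_inverse) (auto simp: retractable_def)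
    then have "Zmap m (\<iota> i ` P i) k (\<lambda>y. f i (r y))"
      by (rule Zmap_compose[OF _ f[OF i]]) (use r in auto)
    then show ?thesis by (rule Zmap_cong) (use h[OF i] r in auto)
  qed
  then have "Zmap m (\<Union>i\<in>I. \<iota> i ` P i) k h" using \<open>finite I\<close> by (intro Zmap_UN)
  then show ?thesis using h by (intro exI[of _ h]) simp
qed

lemma PZ_hom_iff:
  "f \<in> PZ_hom (n, P) (m, Q) \<longleftrightarrow> f \<in> extensional P \<and> Zmap n P m f \<and> f ` P \<subseteq> Q"
  by (simp add: PZ_hom_def)

lemma glue_universal:
  assumes "finite I" and \<iota>: "\<And>i. i \<in> I \<Longrightarrow> retractable (n i) (P i) m (\<iota> i)"
    and f: "\<And>i. i \<in> I \<Longrightarrow> f i \<in> PZ_hom (n i, P i) D"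
    and compat: "\<And>i j x y. \<lbrakk>i \<in> I; j \<in> I; x \<in> P i; y \<in> P j; \<iota> i x = \<iota> j y\<rbrakk> \<Longrightarrow> f i x = f j y"
  shows "\<exists>!h. h \<in> PZ_hom (m, \<Union>i\<in>I. \<iota> i ` P i) D \<and> (\<forall>i\<in>I. compose (P i) h (restrict (\<iota> i) (P i)) = f i)"
proof -
  obtain k S where D: "D = (k, S)" by (cases D)
  define C where "C = (\<Union>i\<in>I. \<iota> i ` P i)"
  have fZ: "Zmap (n i) (P i) k (f i)" "f i ` P i \<subseteq> S" "f i \<in> extensional (P i)" if "i \<in> I" for i
    using f[OF that] by (auto simp: D PZ_hom_iff)
  have "\<exists>h. Zmap m C k h \<and> (\<forall>i\<in>I. \<forall>x\<in>P i. h (\<iota> i x) = f i x)"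
    unfolding C_def
  proof (rule glue_Zmaps[OF assms(1)])
    show "retractable (n i) (P i) m (\<iota> i)" "Zmap (n i) (P i) k (f i)" if "i \<in> I" for i
      using \<iota> fZ(1) that by blast+
    show "f i x = f j y" if "i \<in> I" "j \<in> I" "x \<in> P i" "y \<in> P j" "\<iota> i x = \<iota> j y" for i j x y
      using compat that by blast
  qed
  then obtain h where h: "Zmap m C k h" "\<And>i x. i \<in> I \<Longrightarrow> x \<in> P i \<Longrightarrow> h (\<iota> i x) = f i x"
    by blast
  show ?thesis
    unfolding C_def[symmetric]
  proof (rule ex1I[of _ "restrict h C"])
    have "Zmap m C k (restrict h C)" by (rule Zmap_cong[OF h(1)]) simp
    moreover have "restrict h C ` C \<subseteq> S" using h(2) fZ(2) by (fastforce simp: C_def)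
    ultimately have "restrict h C \<in> PZ_hom (m, C) D" by (simp add: D PZ_hom_iff)
    moreover have "compose (P i) (restrict h C) (restrict (\<iota> i) (P i)) = f i" if i: "i \<in> I" for i
    proof (rule extensionalityI[OF compose_extensional fZ(3)[OF i]])
      fix x assume "x \<in> P i"
      moreover have "\<iota> i x \<in> C" using i calculation by (auto simp: C_def)
      ultimately show "compose (P i) (restrict h C) (restrict (\<iota> i) (P i)) x = f i x"
        using h(2)[OF i] by (simp add: compose_def)
    qed
    ultimately show "restrict h C \<in> PZ_hom (m, C) D \<and> 
        (\<forall>i\<in>I. compose (P i) (restrict h C) (restrict (\<iota> i) (P i)) = f i)" by blast
  next
    fix h' assume h': "h' \<in> PZ_hom (m, C) D \<and> (\<forall>i\<in>I. compose (P i) h' (restrict (\<iota> i) (P i)) = f i)"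
    then have "h' \<in> extensional C" by (simp add: D PZ_hom_iff)
    then show "h' = restrict h C"
    proof (rule extensionalityI[OF _ restrict_extensional])
      fix y assume y: "y \<in> C"
      then obtain i x where x: "i \<in> I" "x \<in> P i" "y = \<iota> i x" by (auto simp: C_def)
      have "h' y = compose (P i) h' (restrict (\<iota> i) (P i)) x" using x by (simp add: compose_def)
      also have "\<dots> = f i x" using h' x(1) by simp
      finally show "h' y = restrict h C y" using h(2) x y by simp
    qed
  qed
qed

lemma rational_polyhedron_UN:
  assumes "finite I" "\<And>i. i \<in> I \<Longrightarrow> rational_polyhedron n (P i)"
  shows "rational_polyhedron n (\<Union>i\<in>I. P i)"
proof -
  have "\<forall>i\<in>I. \<exists>F. finite F \<and> (\<forall>T\<in>F. rational_simplex n T) \<and> P i = \<Union>F"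
    using assms(2) unfolding rational_polyhedron_def by simp
  from bchoice[OF this] obtain F where F: "\<forall>i\<in>I. finite (F i) \<and> (\<forall>T\<in>F i. rational_simplex n T) \<and> P i = \<Union>(F i)" ..
  show ?thesis unfolding rational_polyhedron_def
    by (rule exI[of _ "\<Union>i\<in>I. F i"]) (use F assms(1) in auto)
qed

lemma glue_inclusion:
  assumes "finite I" and \<iota>: "\<And>i. i \<in> I \<Longrightarrow> retractable (n i) (P i) m (\<iota> i)" and "1 \<le> m"
  shows "(m, \<Union>i\<in>I. \<iota> i ` P i) \<in> PZ_obj"
    and "i \<in> I \<Longrightarrow> restrict (\<iota> i) (P i) \<in> PZ_hom (n i, P i) (m, \<Union>i\<in>I. \<iota> i ` P i)"
proof -
  have "rational_polyhedron m (\<iota> i ` P i)" if i: "i \<in> I" for i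
  proof -
    obtain p where p: "\<forall>j<n i. integer_form m (p j)" "\<forall>x\<in>P i. point_of (n i) (\<lambda>j. p j (\<iota> i x)) = x"
      and Z: "Zmap (n i) (P i) m (\<iota> i)"
      using \<iota>[OF i] unfolding retractable_def by blast
    have "Zmap m (\<iota> i ` P i) (n i) (\<lambda>y. point_of (n i) (\<lambda>j. p j y))"
      using Z p by (intro Zmap_left_inverse) auto
    then show ?thesis by (rule Zmap_polyhedron)
  qed
  then have "rational_polyhedron m (\<Union>i\<in>I. \<iota> i ` P i)" using assms(1) by (intro rational_polyhedron_UN)
  then show "(m, \<Union>i\<in>I. \<iota> i ` P i) \<in> PZ_obj" using assms(3) by (simp add: PZ_obj_def)
  show "restrict (\<iota> i) (P i) \<in> PZ_hom (n i, P i) (m, \<Union>i\<in>I. \<iota> i ` P i)" if i: "i \<in> I"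
  proof -
    have "Zmap (n i) (P i) m (\<iota> i)" using \<iota>[OF i] unfolding retractable_def by blast
    then have "Zmap (n i) (P i) m (restrict (\<iota> i) (P i))" by (rule Zmap_cong) simp
    then show ?thesis using i by (auto simp: PZ_hom_iff)
  qed
qed

section \<open>Coproducts\<close>

theorem PZ_coproduct_exists:
  assumes A: "\<And>i. i < k \<Longrightarrow> A i \<in> PZ_obj"
  shows "\<exists>C \<iota>. PZ_coproduct {..<k::nat} A C \<iota>"
proof -
  define n where "n i = fst (A i)" for i
  define P where "P i = snd (A i)" for i
  define N where "N = (\<Sum>i<k. n i)"
  \<comment> \<open>coordinate N carries the index of the summand and keeps the images disjoint\<close>
  define \<iota> where "\<iota> i x = point_of (Suc N) (\<lambda>j. if j < n i then Poly_Mapping.lookup x j else if j = N then real i else 0)" 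
    for i and x :: point
  have P: "rational_polyhedron (n i) (P i)" if "i < k" for i
    using A[OF that] by (auto simp: PZ_obj_def n_def P_def)
  have nN: "n i \<le> N" if "i < k" for i unfolding N_def using that by (intro member_le_sum) auto
  have ret: "retractable (n i) (P i) (Suc N) (\<iota> i)" if i: "i \<in> {..<k}" for i
  proof -
    have "Zmap (n i) (P i) (Suc N) (\<iota> i)" unfolding \<iota>_def
    proof (rule lattice_forms_Zmap)
      show "lattice_form (n i) (\<lambda>x. if j < n i then Poly_Mapping.lookup x j else if j = N then real i else 0)" for j
        by (cases "j < n i"; cases "j = N") (simp_all add: lattice_form_coord lattice_form_const)
    qed (use P i in auto)
    moreover have "point_of (n i) (\<lambda>j. Poly_Mapping.lookup (\<iota> i x) j) = x" if "x \<in> P i" for x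
      using Zmap_dom_Rspace[OF calculation that] nN[of i] i by (intro Rspace_eqI[of _ "n i"]) (auto simp: \<iota>_def)
    moreover have "integer_form (Suc N) (\<lambda>y. Poly_Mapping.lookup y j)" if "j < n i" for j
      using that nN[of i] i by (intro integer_form_coord) auto
    ultimately show ?thesis unfolding retractable_def
      by (intro conjI exI[of _ "\<lambda>j y. Poly_Mapping.lookup y j"]) auto
  qed
  have disjoint: "i = j \<and> x = y" if "i \<in> {..<k}" "j \<in> {..<k}" "x \<in> P i" "y \<in> P j" "\<iota> i x = \<iota> j y" for i j x y
  proof -
    have "Poly_Mapping.lookup (\<iota> i x) N = Poly_Mapping.lookup (\<iota> j y) N" using that by simp
    then have ij: "i = j" using nN[of i] nN[of j] that by (auto simp: \<iota>_def)
    then show ?thesis using ret[OF that(1)] that unfolding retractable_def by metis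
  qed
  have Aeq: "A i = (n i, P i)" for i by (simp add: n_def P_def)
  have "PZ_coproduct {..<k} A (Suc N, \<Union>i\<in>{..<k}. \<iota> i ` P i) (\<lambda>i. restrict (\<iota> i) (P i))"
    unfolding PZ_coproduct_def Aeq snd_conv
    using glue_inclusion[where I = "{..<k}" and n = n and P = P and m = "Suc N" and \<iota> = \<iota>, OF _ ret]
      glue_universal[where I = "{..<k}" and n = n and P = P and m = "Suc N" and \<iota> = \<iota>, OF _ ret] disjoint
    by (intro conjI ballI allI impI) (simp_all, blast)
  then show ?thesis by blast
qed

section \<open>Pushouts of strict Z-maps\<close>

lemma graph_retractable:
  assumes "rational_polyhedron n P" "\<And>i. i < m \<Longrightarrow> lattice_form n (g i)"
    and p: "\<And>j. j < n \<Longrightarrow> s j < m" "\<And>j. j < n \<Longrightarrow> g (s j) = (\<lambda>x. Poly_Mapping.lookup x j)"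
  shows "retractable n P m (\<lambda>x. point_of m (\<lambda>i. g i x))"
  unfolding retractable_def
proof (intro conjI exI[of _ "\<lambda>j y. Poly_Mapping.lookup y (s j)"] allI impI ballI)
  show Z: "Zmap n P m (\<lambda>x. point_of m (\<lambda>i. g i x))" using assms(1,2) by (rule lattice_forms_Zmap)
  show "integer_form m (\<lambda>y. Poly_Mapping.lookup y (s j))" if "j < n" for j
    using p(1)[OF that] by (rule integer_form_coord)
  show "point_of n (\<lambda>j. Poly_Mapping.lookup (point_of m (\<lambda>i. g i x)) (s j)) = x" if x: "x \<in> P" for x
    using Zmap_dom_Rspace[OF Z x] p by (intro Rspace_eqI[of _ n]) auto
qed

text \<open>
  The Z-map \<open>\<mu> \<circ> \<eta>\<^sup>-\<^sup>1\<close>, extended from \<open>\<eta>(P)\<close> to the ambient space of \<open>Q\<close>.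
\<close>

lemma strict_Zmap_transition:
  assumes "strict_Zmap (np, P) (nq, Q) \<eta>" "strict_Zmap (np, P) (nr, R) \<mu>"
  shows "\<exists>g. (\<forall>i<nr. lattice_form nq (g i)) \<and> (\<forall>x\<in>P. point_of nr (\<lambda>i. g i (\<eta> x)) = \<mu> x)"
proof -
  define \<rho> where "\<rho> = restrict (inv_into P \<eta>) (\<eta> ` P)"
  have inj: "inj_on \<eta> P" and \<rho>: "Zmap nq (\<eta> ` P) np \<rho>" and img: "\<rho> ` \<eta> ` P \<subseteq> P"
    using assms(1) by (simp_all add: strict_Zmap_def Z_homeomorphism_def PZ_hom_iff \<rho>_def)
  have "Zmap np P nr \<mu>" using assms(2) by (simp add: strict_Zmap_def PZ_hom_iff)
  from Zmap_compose[OF \<rho> this img] have "Zmap nq (\<eta> ` P) nr (\<lambda>y. \<mu> (\<rho> y))" .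
  from Zmap_extension[OF this] obtain g where g: "\<forall>i<nr. lattice_form nq (g i)" 
    "\<And>y. y \<in> \<eta> ` P \<Longrightarrow> \<mu> (\<rho> y) = point_of nr (\<lambda>i. g i y)"
    by blast
  have "\<rho> (\<eta> x) = x" if "x \<in> P" for x using that inj by (simp add: \<rho>_def)
  then have "point_of nr (\<lambda>i. g i (\<eta> x)) = \<mu> x" if "x \<in> P" for x using g(2)[of "\<eta> x"] that by simp
  then show ?thesis using g(1) by blast
qed

text \<open>
  Below, \<open>a\<close> and \<open>b\<close> are the coordinate functions of \<open>\<sigma> x = (x, \<Theta> x, \<delta> x)\<close> and \<open>\<tau> y = (\<Theta>' y, y, 0)\<close>.
  The left inverse of \<open>\<sigma>\<close> reads off the first block of coordinates, that of \<open>\<tau>\<close> the second.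
\<close>

theorem PZ_pushout_exists:
  assumes Q: "(nq, Q) \<in> PZ_obj" and R: "(nr, R) \<in> PZ_obj"
    and \<eta>: "strict_Zmap (np, P) (nq, Q) \<eta>" and \<mu>: "strict_Zmap (np, P) (nr, R) \<mu>"
  shows "\<exists>S \<sigma> \<tau>. PZ_pushout (np, P) (nq, Q) (nr, R) \<eta> \<mu> S \<sigma> \<tau>"
proof -
  obtain g where g: "\<And>i. i < nr \<Longrightarrow> lattice_form nq (g i)"
    "\<And>x. x \<in> P \<Longrightarrow> point_of nr (\<lambda>i. g i (\<eta> x)) = \<mu> x"
    using strict_Zmap_transition[OF \<eta> \<mu>] by blast
  obtain g' where g': "\<And>i. i < nq \<Longrightarrow> lattice_form nr (g' i)"
    "\<And>x. x \<in> P \<Longrightarrow> point_of nq (\<lambda>i. g' i (\<mu> x)) = \<eta> x"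
    using strict_Zmap_transition[OF \<mu> \<eta>] by blast
  have maps: "\<eta> ` P \<subseteq> Q" "\<mu> ` P \<subseteq> R"
    using \<eta> \<mu> by (simp_all add: strict_Zmap_def PZ_hom_iff)
  have "rational_polyhedron nq (\<eta> ` P)"
    using \<eta> by (auto simp: strict_Zmap_def Z_homeomorphism_def PZ_hom_iff intro: Zmap_polyhedron)
  from polyhedron_zero_form[OF this]
  obtain d where d: "lattice_form nq d" "\<And>x. x \<in> Rspace nq \<Longrightarrow> d x = 0 \<longleftrightarrow> x \<in> \<eta> ` P"
    by blast
  define s where "s = Suc (nq + nr)"
  define a where "a i = (if i < nq then \<lambda>x. Poly_Mapping.lookup x i else if i < nq + nr then g (i - nq) else d)" for i
  define b where "b i = (if i < nq then g' i else if i < nq + nr then \<lambda>x. Poly_Mapping.lookup x (i - nq) else (\<lambda>x. 0))" for i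
  define \<sigma> where "\<sigma> x = point_of s (\<lambda>i. a i x)" for x
  define \<tau> where "\<tau> x = point_of s (\<lambda>i. b i x)" for x
  have polyQ: "rational_polyhedron nq Q" and polyR: "rational_polyhedron nr R"
    using Q R by (auto simp: PZ_obj_def)
  have QR: "Q \<subseteq> Rspace nq" "R \<subseteq> Rspace nr"
    using polyQ polyR rational_polytope_subset by (blast elim: rational_polyhedronE)+
  have ret\<sigma>: "retractable nq Q s \<sigma>"
    unfolding \<sigma>_def
    by (rule graph_retractable[OF polyQ, where s = "\<lambda>j. j"])
       (use g(1) d(1) in \<open>auto simp: a_def s_def intro: lattice_form_coord\<close>)
  have ret\<tau>: "retractable nr R s \<tau>"
    unfolding \<tau>_def
    by (rule graph_retractable[OF polyR, where s = "\<lambda>j. nq + j"])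
       (use g'(1) in \<open>auto simp: b_def s_def lattice_form_const intro: lattice_form_coord\<close>)
  have agree: "\<sigma> (\<eta> x) = \<tau> (\<mu> x)" if x: "x \<in> P" for x
  proof (rule Rspace_eqI[of _ s])
    fix i assume i: "i < s"
    have Rs: "\<eta> x \<in> Rspace nq" "\<mu> x \<in> Rspace nr" using maps QR x by auto
    consider "i < nq" | "nq \<le> i" "i < nq + nr" | "i = nq + nr" using i unfolding s_def by linarith
    then show "Poly_Mapping.lookup (\<sigma> (\<eta> x)) i = Poly_Mapping.lookup (\<tau> (\<mu> x)) i"
    proof cases
      case 1
      then show ?thesis using arg_cong[OF g'(2)[OF x], of "\<lambda>y. Poly_Mapping.lookup y i"] i
        by (simp add: \<sigma>_def \<tau>_def a_def b_def)
    next
      case 2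
      then have "i - nq < nr" by linarith
      then show ?thesis using 2 arg_cong[OF g(2)[OF x], of "\<lambda>y. Poly_Mapping.lookup y (i - nq)"] i
        by (simp add: \<sigma>_def \<tau>_def a_def b_def)
    next
      case 3
      have "d (\<eta> x) = 0" using d(2)[OF Rs(1)] x by blast
      then show ?thesis using 3 i by (simp add: \<sigma>_def \<tau>_def a_def b_def)
    qed
  qed (simp_all add: \<sigma>_def \<tau>_def)
  \<comment> \<open>the last coordinate confines the overlap of the two images to P\<close>
  have separate: "\<exists>x\<in>P. u = \<eta> x \<and> v = \<mu> x" if u: "u \<in> Q" and v: "v \<in> R" and eq: "\<sigma> u = \<tau> v" for u v
  proof -
    have "Poly_Mapping.lookup (\<sigma> u) (nq + nr) = Poly_Mapping.lookup (\<tau> v) (nq + nr)" using eq by simp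
    then have "d u = 0" by (simp add: \<sigma>_def \<tau>_def a_def b_def s_def)
    then obtain x where x: "x \<in> P" "u = \<eta> x" using d(2) u QR by blast
    have "\<tau> v = \<tau> (\<mu> x)" using eq agree x by simp
    moreover have "\<mu> x \<in> R" using maps x by blast
    ultimately have "v = \<mu> x" using ret\<tau> v unfolding retractable_def by metis
    then show ?thesis using x by blast
  qed
  have inj: "u = u'" if "u \<in> Q" "u' \<in> Q" "\<sigma> u = \<sigma> u'" for u u'
    using ret\<sigma> that unfolding retractable_def by metis
  have inj': "v = v'" if "v \<in> R" "v' \<in> R" "\<tau> v = \<tau> v'" for v v'
    using ret\<tau> that unfolding retractable_def by metis
  \<comment> \<open>the two-element family indexed by the truth values\<close>
  define \<iota> where "\<iota> c = (if c then \<sigma> else \<tau>)" for c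
  define n where "n c = (if c then nq else nr)" for c
  define X where "X c = (if c then Q else R)" for c
  have ret: "retractable (n c) (X c) s (\<iota> c)" if "c \<in> UNIV" for c
    using ret\<sigma> ret\<tau> by (simp add: \<iota>_def n_def X_def)
  define S where "S = (s, \<Union>c\<in>UNIV. \<iota> c ` X c)"
  have finU: "finite (UNIV :: bool set)" by simp
  have s1: "1 \<le> s" by (simp add: s_def)
  note incl = glue_inclusion[where I = UNIV and n = n and P = X and m = s and \<iota> = \<iota>, OF finU ret s1, folded S_def]
  have S: "S \<in> PZ_obj" using incl(1) by simp
  have hom: "restrict \<sigma> Q \<in> PZ_hom (nq, Q) S" "restrict \<tau> R \<in> PZ_hom (nr, R) S"
    using incl(2)[of True] incl(2)[of False] by (simp_all add: \<iota>_def n_def X_def)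
  have comm: "compose P (restrict \<sigma> Q) \<eta> = compose P (restrict \<tau> R) \<mu>"
    using maps agree by (intro extensionalityI[OF compose_extensional compose_extensional]) (auto simp: compose_def image_subset_iff)
  have univ: "\<exists>!h. h \<in> PZ_hom S D \<and> compose Q h (restrict \<sigma> Q) = u \<and> compose R h (restrict \<tau> R) = v"
    if u: "u \<in> PZ_hom (nq, Q) D" and v: "v \<in> PZ_hom (nr, R) D" and uv: "compose P u \<eta> = compose P v \<mu>" for D u v
  proof -
    define f where "f c = (if c then u else v)" for c
    have eq: "u (\<eta> x) = v (\<mu> x)" if "x \<in> P" for x
      using fun_cong[OF uv, of x] that by (simp add: compose_def)
    have "\<exists>!h. h \<in> PZ_hom S D \<and> (\<forall>c\<in>UNIV. compose (X c) h (restrict (\<iota> c) (X c)) = f c)"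
      unfolding S_def
    proof (rule glue_universal[where n = n])
      show "f c \<in> PZ_hom (n c, X c) D" for c using u v by (simp add: f_def n_def X_def)
      have mixed: "u x = v y" if xy: "x \<in> Q" "y \<in> R" "\<sigma> x = \<tau> y" for x y
      proof -
        obtain z where "z \<in> P" "x = \<eta> z" "y = \<mu> z" using separate[OF xy] by blast
        then show ?thesis using eq by simp
      qed
      show "f c x = f c' y" if xy: "x \<in> X c" "y \<in> X c'" "\<iota> c x = \<iota> c' y" for c c' x y
      proof (cases c)
        case c: True
        show ?thesis
        proof (cases c')
          case True
          then show ?thesis using inj[of x y] xy c by (simp add: f_def \<iota>_def X_def)
        next
          case False
          then show ?thesis using mixed[of x y] xy c by (simp add: f_def \<iota>_def X_def)
        qed
      next
        case c: False
        show ?thesis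
        proof (cases c')
          case True
          then show ?thesis using mixed[of y x] xy c by (simp add: f_def \<iota>_def X_def)
        next
          case False
          then show ?thesis using inj'[of x y] xy c by (simp add: f_def \<iota>_def X_def)
        qed
      qed
    qed (use ret in auto)
    moreover have "(\<forall>c\<in>UNIV. compose (X c) h (restrict (\<iota> c) (X c)) = f c) \<longleftrightarrow>
        compose Q h (restrict \<sigma> Q) = u \<and> compose R h (restrict \<tau> R) = v" for h
      by (simp add: all_bool_eq f_def \<iota>_def X_def)
    ultimately show ?thesis by simp
  qed
  have "PZ_pushout (np, P) (nq, Q) (nr, R) \<eta> \<mu> S (restrict \<sigma> Q) (restrict \<tau> R)"
    unfolding PZ_pushout_def snd_conv using S hom comm univ by blast
  then show ?thesis by blast
qed

theorem theorem3p12: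
  shows "(\<forall>(k::nat) (A :: nat \<Rightarrow> polyhedron_obj). (\<forall>i<k. A i \<in> PZ_obj) \<longrightarrow>
            (\<exists>C \<iota>. PZ_coproduct {..<k} A C \<iota>)) \<and>
         (\<forall>P\<in>PZ_obj. \<forall>Q\<in>PZ_obj. \<forall>R\<in>PZ_obj. \<forall>\<eta> \<mu>.
            strict_Zmap P Q \<eta> \<and> strict_Zmap P R \<mu> \<longrightarrow>
            (\<exists>S \<sigma> \<tau>. PZ_pushout P Q R \<eta> \<mu> S \<sigma> \<tau>))"
  using PZ_coproduct_exists PZ_pushout_exists by (auto split: prod.splits)

end
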